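(* For all $\mathfrak u,\mathfrak v\in\langle\Gamma\rangle$, $\Delta(\mathfrak u\sqcup\!\sqcup\mathfrak v)=\Delta(\mathfrak u)\sqcup\!\sqcup\Delta(\mathfrak v)$.
   Context: Let $q$ be a prime power. Let $\Gamma=\{x_{n,\varepsilon}\}_{n\in\mathbb N,\varepsilon\in\mathbb F_q^*}$ with weights $w(x_{n,\varepsilon})=n$, $\langle\Gamma\rangle$ the set of words over $\Gamma$ (empty word $1$, juxtaposition = concatenation, depth = number of letters, weight = sum of letter weights), $\mathfrak D$ the $\mathbb F_q$-vector space with basis $\langle\Gamma\rangle$; write $x_n:=x_{n,1}$. For positive integers $r,s,j$ put $\Delta^j_{r,s}=(-1)^{r-1}\binom{j-1}{r-1}+(-1)^{s-1}\binom{j-1}{s-1}$ if $(q-1)\mid j$ and $0$ otherwise. The bilinear products $\diamond,\sqcup\!\sqcup$ on $\mathfrak D$ are defined recursively by $1\diamond\mathfrak a=\mathfrak a\diamond1=\mathfrak a$, $1\sqcup\!\sqcup\mathfrak a=\mathfrak a\sqcup\!\sqcup1=\mathfrak a$ and, for nonempty $\mathfrak a=x_{a,\alpha}\mathfrak a_-$, $\mathfrak b=x_{b,\beta}\mathfrak b_-$: $\mathfrak a\diamond\mathfrak b=x_{a+b,\alpha\beta}(\mathfrak a_-\sqcup\!\sqcup\mathfrak b_-)+\sum_{i+j=a+b}\Delta^j_{a,b}x_{i,\alpha\beta}(x_j\sqcup\!\sqcup(\mathfrak a_-\sqcup\!\sqcup\mathfrak b_-))$, $\mathfrak a\sqcup\!\sqcup\mathfrak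 b=x_{a,\alpha}(\mathfrak a_-\sqcup\!\sqcup\mathfrak b)+x_{b,\beta}(\mathfrak a\sqcup\!\sqcup\mathfrak b_-)+\mathfrak a\diamond\mathfrak b$. For a word $\mathfrak a=x_{i_1}\cdots x_{i_m}$ with all characters $1$ put $[\mathfrak a]=(-1)^m\Delta^{i_1}_{1,w(\mathfrak a)+1}\cdots\Delta^{i_m}_{1,w(\mathfrak a)+1}x_{i_1}\sqcup\!\sqcup\cdots\sqcup\!\sqcup x_{i_m}$, $[1]=1$. The coproduct $\Delta:\mathfrak D\to\mathfrak D\otimes\mathfrak D$ is linear with $\Delta(1)=1\otimes1$, $\Delta(x_{n,\varepsilon})=1\otimes x_{n,\varepsilon}+\sum_{r\ge1,\ r+w(\mathfrak a)=n}\binom{r+\mathrm{depth}(\mathfrak a)-2}{\mathrm{depth}(\mathfrak a)}x_{r,\varepsilon}\otimes[\mathfrak a]$ (sum over words $\mathfrak a$ with all characters $1$), and for $\mathfrak u=x_{u,\varepsilon}\mathfrak v$ of depth $\ge2$, writing $\Delta(x_{u,\varepsilon})=1\otimes x_{u,\varepsilon}+\sum a\otimes b$ and $\Delta(\mathfrak v)=\sum a_{\mathfrak v}\otimes b_{\mathfrak v}$, $\Delta(\mathfrak u)=1\otimes\mathfrak u+\sum(a\,a_{\mathfrak v})\otimes(b\sqcup\!\sqcup b_{\mathfrak v})$. On $\mathfrak D\otimes\mathfrak D$, $(a\otimes b)\sqcup\!\sqcup(c\otimes d)=(a\sqcup\!\sqcup c)\otimes(b\sqcup\!\sqcup d)$.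 *)

theory Defs
  imports Main
begin

text \<open>Letters x_{n,eps} are pairs (n, eps); words are lists of letters.
  The base field F_q is a finite field type 'k, q = CARD('k).
  Elements of the F_q-space D with basis the words are coefficient functions
  word => 'k (all elements used have finite support); elements of D (x) D are
  coefficient functions on pairs of words (basis of the tensor product).\<close>

type_synonym 'k letter = "nat \<times> 'k"
type_synonym 'k word = "'k letter list"
type_synonym 'k elem = "'k word \<Rightarrow> 'k"
type_synonym 'k tens = "'k word \<times> 'k word \<Rightarrow> 'k"

definition valid_word :: "('k::zero) word \<Rightarrow> bool" where
  "valid_word w \<longleftrightarrow> (\<forall>x\<in>set w. fst x \<ge> 1 \<and> snd x \<noteq> 0)"

definition wt :: "'k word \<Rightarrow> nat" where
  "wt w = sum_list (map fst w)"

definition supp :: "('a \<Rightarrow> 'k::zero) \<Rightarrow> 'a set" where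
  "supp p = {w. p w \<noteq> 0}"

definition mono :: "'k word \<Rightarrow> ('k::{zero,one}) elem" where
  "mono w = (\<lambda>v. if v = w then 1 else 0)"

definition lin :: "('a \<Rightarrow> 'b \<Rightarrow> 'k::comm_ring_1) \<Rightarrow> ('a \<Rightarrow> 'k) \<Rightarrow> 'b \<Rightarrow> 'k" where
  "lin f p = (\<lambda>v. \<Sum>w\<in>supp p. p w * f w v)"

definition bilin :: "('a \<Rightarrow> 'a \<Rightarrow> 'b \<Rightarrow> 'k::comm_ring_1) \<Rightarrow> ('a \<Rightarrow> 'k) \<Rightarrow> ('a \<Rightarrow> 'k) \<Rightarrow> 'b \<Rightarrow> 'k" where
  "bilin f p r = (\<lambda>v. \<Sum>w\<in>supp p. \<Sum>u\<in>supp r. p w * r u * f w u v)"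

definition lcons :: "'k letter \<Rightarrow> ('k::comm_ring_1) elem \<Rightarrow> 'k elem" where
  "lcons x p = lin (\<lambda>w. mono (x # w)) p"

definition DeltaC :: "nat \<Rightarrow> nat \<Rightarrow> nat \<Rightarrow> 'k::{field,finite}" where
  "DeltaC r s j = (if (card (UNIV :: 'k set) - 1) dvd j
     then (-1) ^ (r - 1) * of_nat ((j - 1) choose (r - 1))
        + (-1) ^ (s - 1) * of_nat ((j - 1) choose (s - 1))
     else 0)"

text \<open>The diamond product on basis words, parametrised by the shuffle product
  it calls recursively (extended bilinearly).\<close>
definition dia_gen :: "('k word \<Rightarrow> 'k word \<Rightarrow> ('k::{field,finite}) elem) \<Rightarrow> 'k word \<Rightarrow> 'k word \<Rightarrow> 'k elem" where
  "dia_gen sh a b = (case a of [] \<Rightarrow> mono b | x # a' \<Rightarrow>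
     (case b of [] \<Rightarrow> mono a | y # b' \<Rightarrow>
       (\<lambda>v. lcons (fst x + fst y, snd x * snd y) (sh a' b') v
          + (\<Sum>i\<in>{1..<fst x + fst y}.
               DeltaC (fst x) (fst y) (fst x + fst y - i)
               * lcons (i, snd x * snd y)
                   (lin (\<lambda>w. sh [(fst x + fst y - i, 1)] w) (sh a' b')) v))))"

text \<open>Shuffle product on basis words with a fuel parameter (the recursion is on
  the total depth; fuel >= depth a + depth b suffices).\<close>
primrec shf :: "nat \<Rightarrow> 'k word \<Rightarrow> 'k word \<Rightarrow> ('k::{field,finite}) elem" where
  "shf 0 a b = (if a = [] then mono b else if b = [] then mono a else (\<lambda>_. 0))"
| "shf (Suc N) a b = (case a of [] \<Rightarrow> mono b | x # a' \<Rightarrow>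
     (case b of [] \<Rightarrow> mono a | y # b' \<Rightarrow>
       (\<lambda>v. lcons x (shf N a' b) v + lcons y (shf N a b') v + dia_gen (shf N) a b v)))"

definition sh :: "'k word \<Rightarrow> 'k word \<Rightarrow> ('k::{field,finite}) elem" where
  "sh a b = shf (length a + length b) a b"

definition dia :: "'k word \<Rightarrow> 'k word \<Rightarrow> ('k::{field,finite}) elem" where
  "dia = dia_gen sh"

definition shE :: "('k::{field,finite}) elem \<Rightarrow> 'k elem \<Rightarrow> 'k elem" where
  "shE = bilin sh"

text \<open>[a] for a word all of whose characters are 1; the iterated shuffle
  x_{i1} sh ... sh x_{im} is bracketed to the right.\<close>
definition bracket :: "'k word \<Rightarrow> ('k::{field,finite}) elem" where
  "bracket a = (\<lambda>v. (-1) ^ length a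
      * prod_list (map (\<lambda>x. DeltaC 1 (wt a + 1) (fst x)) a)
      * foldr (\<lambda>x acc. shE (mono [x]) acc) a (mono []) v)"

definition tensor :: "('k::comm_ring_1) elem \<Rightarrow> 'k elem \<Rightarrow> 'k tens" where
  "tensor p r = (\<lambda>(w, v). p w * r v)"

definition tmono :: "'k word \<Rightarrow> 'k word \<Rightarrow> ('k::comm_ring_1) tens" where
  "tmono a b = tensor (mono a) (mono b)"

text \<open>coproduct of a letter. The binomial binom(r + depth a - 2, depth a) is
  computed with natural subtraction; the only case r + depth a < 2 is
  r = 1, a = empty, where both conventions give 1.\<close>
definition cop_letter :: "('k::{field,finite}) letter \<Rightarrow> 'k tens" where
  "cop_letter x = (\<lambda>t. tmono [] [x] t
     + (\<Sum>r\<in>{1..fst x}. \<Sum>a\<in>{a. (\<forall>y\<in>set a. fst y \<ge> 1 \<and> snd y = 1) \<and> wt a = fst x - r}.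
          of_nat ((r + length a - 2) choose length a)
          * tensor (mono [(r, snd x)]) (bracket a) t))"

fun cop :: "('k::{field,finite}) word \<Rightarrow> 'k tens" where
  "cop [] = tmono [] []"
| "cop [x] = cop_letter x"
| "cop (x # y # v) = (\<lambda>t. tmono [] (x # y # v) t
     + (\<Sum>(a, b)\<in>supp (\<lambda>s. cop_letter x s - tmono [] [x] s).
          \<Sum>(c, d)\<in>supp (cop (y # v)).
            (cop_letter x (a, b) - tmono [] [x] (a, b)) * cop (y # v) (c, d)
            * tensor (mono (a @ c)) (sh b d) t))"

definition copE :: "('k::{field,finite}) elem \<Rightarrow> 'k tens" where
  "copE = lin cop"

definition tshE :: "('k::{field,finite}) tens \<Rightarrow> 'k tens \<Rightarrow> 'k tens" where
  "tshE T1 T2 = (\<lambda>t. \<Sum>(a, b)\<in>supp T1. \<Sum>(c, d)\<in>supp T2.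
      T1 (a, b) * T2 (c, d) * tensor (sh a c) (sh b d) t)"

end

theory Submission
  imports Defs "HOL-Computational_Algebra.Formal_Laurent_Series"
begin

text \<open>
  Embed \<open>F\<^sub>q\<close> in an infinite field \<open>K\<close>. Call a list of \<open>F\<^sub>q\<close>-independent elements
  \<open>v\<^sub>0, v\<^sub>1, \<dots>\<close> of \<open>K\<close> a flag, with spans \<open>V\<^sub>0 \<subset> V\<^sub>1 \<subset> \<dots>\<close>; a word \<open>x\<^bsub>n,\<epsilon>\<^esub> u\<close> is evaluated
  on it as \<open>\<Sum>\<^sub>d \<epsilon>\<^bsup>k(d)\<^esup> S\<^sub>d(u) \<Sum>\<^bsub>c \<in> V\<^sub>d\<^esub> (v\<^sub>d + c)\<^bsup>-n\<^esup>\<close>, where \<open>S\<^sub>d\<close> uses the levels below \<open>d\<close> only and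
  the exponents \<open>k(d)\<close> are arbitrary. By partial fractions the shuffle product becomes the
  product of values. If the flag is cut into a lower part with span \<open>V\<close> and an upper part, then
  the additive polynomial \<open>E\<close> with kernel \<open>V\<close> carries the upper part to a flag again, and
  \<open>\<Sum>\<^bsub>c \<in> V\<^esub> 1 / (a + c - t) = 1 / (E(a) - E(t))\<close> shows that the value of a word on the whole flag is the
  value of its coproduct on the pair (image of the upper part, lower part): the bracket terms are
  the coefficients of the powers of \<open>E(t) / t\<close>. So both sides of the claim have the same value on
  all such pairs, and the values separate tensors because poles of different orders are
  linearly independent.
\<close>

section \<open>Functions with finite support\<close>

text \<open>Elements of the spaces are functions, and \<open>lin\<close>, \<open>bilin\<close> and
  \<open>tshE\<close> sum over supports. A sum over an infinite set is 0 by convention, so linearity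
  is argued for finite supports; \<open>A\<close> records side conditions on the words that
  occur.\<close>

definition fsupp :: "'a set \<Rightarrow> ('a \<Rightarrow> 'k::zero) set" where
  "fsupp A = {p. finite (supp p) \<and> supp p \<subseteq> A}"

lemma fsuppI: "finite B \<Longrightarrow> B \<subseteq> A \<Longrightarrow> (\<And>w. w \<notin> B \<Longrightarrow> p w = 0) \<Longrightarrow> p \<in> fsupp A"
  unfolding fsupp_def supp_def by (auto intro: finite_subset[of _ B])

lemma fsuppD: "p \<in> fsupp A \<Longrightarrow> finite (supp p)" "p \<in> fsupp A \<Longrightarrow> w \<in> supp p \<Longrightarrow> w \<in> A"
  by (auto simp: fsupp_def)

lemma fsupp_subset: "p \<in> fsupp A \<Longrightarrow> A \<subseteq> B \<Longrightarrow> p \<in> fsupp B"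
  by (auto simp: fsupp_def)

lemma fsupp_zero: "(\<lambda>_. 0) \<in> fsupp A"
  by (simp add: fsupp_def supp_def)

lemma fsupp_add:
  fixes p r :: "'a \<Rightarrow> 'k::monoid_add"
  assumes "p \<in> fsupp A" "r \<in> fsupp A"
  shows "(\<lambda>v. p v + r v) \<in> fsupp A"
  using assms by (intro fsuppI[of "supp p \<union> supp r"]) (auto simp: fsupp_def supp_def)

lemma fsupp_diff:
  fixes p r :: "'a \<Rightarrow> 'k::group_add"
  assumes "p \<in> fsupp A" "r \<in> fsupp A"
  shows "(\<lambda>v. p v - r v) \<in> fsupp A"
  using assms by (intro fsuppI[of "supp p \<union> supp r"]) (auto simp: fsupp_def supp_def)

lemma fsupp_scale:
  fixes p :: "'a \<Rightarrow> 'k::mult_zero"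
  assumes "p \<in> fsupp A"
  shows "(\<lambda>v. c * p v) \<in> fsupp A"
  using assms by (intro fsuppI[of "supp p"]) (auto simp: fsupp_def supp_def)

lemma fsupp_sum:
  fixes f :: "'i \<Rightarrow> 'a \<Rightarrow> 'k::comm_monoid_add"
  assumes "\<And>i. i \<in> I \<Longrightarrow> f i \<in> fsupp A"
  shows "(\<lambda>v. \<Sum>i\<in>I. f i v) \<in> fsupp A"
  using assms
proof (induction I rule: infinite_finite_induct)
  case (insert i I)
  then show ?case using fsupp_add[of "f i" A "\<lambda>v. \<Sum>i\<in>I. f i v"] by simp
qed (simp_all add: fsupp_zero)

lemma fsupp_mono: "w \<in> A \<Longrightarrow> mono w \<in> fsupp A"
  by (rule fsuppI[of "{w}"]) (auto simp: mono_def)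

lemma fsupp_lin:
  assumes "p \<in> fsupp B" "\<And>w. w \<in> B \<Longrightarrow> f w \<in> fsupp A"
  shows "lin f p \<in> fsupp A"
  unfolding lin_def by (intro fsupp_sum fsupp_scale assms(2) fsuppD(2)[OF assms(1)])

lemma fsupp_lcons:
  assumes "p \<in> fsupp B" "\<And>w. w \<in> B \<Longrightarrow> x # w \<in> A"
  shows "lcons x p \<in> fsupp A"
  unfolding lcons_def by (intro fsupp_lin[OF assms(1)] fsupp_mono assms(2))

lemma fsupp_bilin:
  assumes "p \<in> fsupp B" "r \<in> fsupp C" "\<And>w u. w \<in> B \<Longrightarrow> u \<in> C \<Longrightarrow> f w u \<in> fsupp A"
  shows "bilin f p r \<in> fsupp A"
  unfolding bilin_def
  by (intro fsupp_sum fsupp_scale assms(3) fsuppD(2)[OF assms(1)] fsuppD(2)[OF assms(2)])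

lemma fsupp_tensor:
  fixes p r :: "'k::comm_ring_1 elem"
  assumes "p \<in> fsupp A" "r \<in> fsupp B"
  shows "tensor p r \<in> fsupp (A \<times> B)"
  using assms
  by (intro fsuppI[of "supp p \<times> supp r"]) (auto simp: fsupp_def supp_def tensor_def)

section \<open>Supports of the products and of the coproduct\<close>

definition pos_words :: "'k word set" where
  "pos_words = {w. \<forall>x\<in>set w. fst x \<ge> 1}"

lemma pos_words_Nil [simp]: "[] \<in> pos_words"
  and pos_words_Cons [simp]: "x # w \<in> pos_words \<longleftrightarrow> fst x \<ge> 1 \<and> w \<in> pos_words"
  and pos_words_append [simp]: "u @ w \<in> pos_words \<longleftrightarrow> u \<in> pos_words \<and> w \<in> pos_words"
  by (auto simp: pos_words_def)

lemma dia_gen_Cons: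
  "dia_gen m (x # a) (y # b) = (\<lambda>v.
     lcons (fst x + fst y, snd x * snd y) (m a b) v
     + (\<Sum>i\<in>{1..<fst x + fst y}. DeltaC (fst x) (fst y) (fst x + fst y - i)
          * lcons (i, snd x * snd y) (lin (\<lambda>w. m [(fst x + fst y - i, 1)] w) (m a b)) v))"
  by (simp add: dia_gen_def)

text \<open>The length bound belongs to the induction: the diamond product applies
  \<open>shf N\<close> to a letter and a word from the support of another product, and the fuel has
  to suffice for that word.\<close>

lemma fsupp_shf:
  fixes a b :: "'k::{field,finite} word"
  assumes "length a + length b \<le> N" "a \<in> pos_words" "b \<in> pos_words"
  shows "shf N a b \<in> fsupp {w \<in> pos_words. length w \<le> length a + length b}"
  using assms
proof (induction N arbitrary: a b)
  case 0
  then show ?case by (auto intro: fsupp_mono)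
next
  case (Suc N)
  show ?case
  proof (cases "a = [] \<or> b = []")
    case True
    then show ?thesis using Suc.prems by (auto intro!: fsupp_mono split: list.split)
  next
    case False
    then obtain x a' y b' where ab: "a = x # a'" "b = y # b'"
      by (metis neq_Nil_conv)
    note IH = Suc.IH[THEN fsupp_lcons]
    let ?L = "{w \<in> pos_words. length w \<le> length a + length b}"
    have 1: "lcons x (shf N a' b) \<in> fsupp ?L" "lcons y (shf N a b') \<in> fsupp ?L"
      "lcons (fst x + fst y, snd x * snd y) (shf N a' b') \<in> fsupp ?L"
      by (rule IH; use Suc.prems ab in auto)+
    have 2: "lin (\<lambda>w. shf N [(fst x + fst y - i, 1)] w) (shf N a' b')
        \<in> fsupp {w \<in> pos_words. length w \<le> length a' + length b' + 1}"
      if "i \<in> {1..<fst x + fst y}" for i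
    proof (rule fsupp_lin)
      show "shf N a' b' \<in> fsupp {w \<in> pos_words. length w \<le> length a' + length b'}"
        using Suc.prems ab by (intro Suc.IH) auto
      show "shf N [(fst x + fst y - i, 1)] w \<in> fsupp {w \<in> pos_words. length w \<le> length a' + length b' + 1}"
        if "w \<in> {w \<in> pos_words. length w \<le> length a' + length b'}" for w :: "'k word"
      proof -
        have "shf N [(fst x + fst y - i, 1)] w
            \<in> fsupp {v \<in> pos_words. length v \<le> length [(fst x + fst y - i, 1 :: 'k)] + length w}"
          using that \<open>i \<in> _\<close> Suc.prems ab by (intro Suc.IH) auto
        then show ?thesis using that by (auto elim!: fsupp_subset)
      qed
    qed
    have 3: "lcons (i, snd x * snd y) (lin (\<lambda>w. shf N [(fst x + fst y - i, 1)] w) (shf N a' b'))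
        \<in> fsupp ?L" if "i \<in> {1..<fst x + fst y}" for i
      by (rule fsupp_lcons[OF 2[OF that]]) (use ab that in auto)
    have "shf (Suc N) a b = (\<lambda>v. lcons x (shf N a' b) v + lcons y (shf N a b') v
        + dia_gen (shf N) a b v)"
      by (simp add: ab)
    also have "\<dots> \<in> fsupp ?L"
      unfolding ab dia_gen_Cons
      by (intro fsupp_add fsupp_sum fsupp_scale; fact 1[unfolded ab] 3[unfolded ab])
    finally show ?thesis .
  qed
qed

lemma fsupp_sh: "a \<in> pos_words \<Longrightarrow> b \<in> pos_words \<Longrightarrow> sh a b \<in> fsupp pos_words"
  unfolding sh_def using fsupp_shf[of a b "length a + length b"] by (auto elim: fsupp_subset)

lemma fsupp_shE: "p \<in> fsupp pos_words \<Longrightarrow> r \<in> fsupp pos_words \<Longrightarrow> shE p r \<in> fsupp pos_words"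
  unfolding shE_def by (erule fsupp_bilin) (auto intro: fsupp_sh)

lemma fsupp_bracket: "a \<in> pos_words \<Longrightarrow> bracket a \<in> fsupp pos_words"
proof -
  assume "a \<in> pos_words"
  then have "foldr (\<lambda>x. shE (mono [x])) a (mono []) \<in> fsupp pos_words"
    by (induction a) (auto intro!: fsupp_shE fsupp_mono)
  then show ?thesis unfolding bracket_def by (rule fsupp_scale)
qed

definition unit_words :: "nat \<Rightarrow> 'k::one word set" where
  "unit_words n = {a. (\<forall>y\<in>set a. fst y \<ge> 1 \<and> snd y = 1) \<and> wt a = n}"

lemma unit_words_pos: "a \<in> unit_words n \<Longrightarrow> a \<in> pos_words"
  by (auto simp: unit_words_def pos_words_def)

text \<open>The coproduct of a letter without its first term: the part that the recursion for longer
  words multiplies on.\<close>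

definition cop_red :: "'k::{field,finite} letter \<Rightarrow> 'k tens" where
  "cop_red x = (\<lambda>t. \<Sum>r\<in>{1..fst x}. \<Sum>a\<in>unit_words (fst x - r).
     of_nat ((r + length a - 2) choose length a) * tensor (mono [(r, snd x)]) (bracket a) t)"

lemma cop_letter_eq: "cop_letter x = (\<lambda>t. tmono [] [x] t + cop_red x t)"
  by (simp add: cop_letter_def cop_red_def unit_words_def)

lemma fsupp_cop_red: "cop_red x \<in> fsupp ({[(r, snd x)] | r. r \<ge> 1} \<times> pos_words)"
  unfolding cop_red_def
  by (intro fsupp_sum fsupp_scale fsupp_tensor fsupp_mono fsupp_bracket)
     (auto dest: unit_words_pos)

lemma fsupp_tmono: "a \<in> A \<Longrightarrow> b \<in> B \<Longrightarrow> tmono a b \<in> fsupp (A \<times> B)"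
  unfolding tmono_def by (intro fsupp_tensor fsupp_mono)

lemma cop_Cons_Cons: "cop (x # y # v) = (\<lambda>t. tmono [] (x # y # v) t
     + (\<Sum>s\<in>supp (cop_red x). \<Sum>s'\<in>supp (cop (y # v)).
          cop_red x s * cop (y # v) s' * tensor (mono (fst s @ fst s')) (sh (snd s) (snd s')) t))"
  by (simp add: cop_letter_eq case_prod_unfold)

lemma fsupp_cop: "u \<in> pos_words \<Longrightarrow> cop u \<in> fsupp (pos_words \<times> pos_words)"
proof (induction u rule: cop.induct)
  case 1
  then show ?case by (auto intro: fsupp_tmono)
next
  case (2 x)
  then show ?case unfolding cop.simps cop_letter_eq
    by (intro fsupp_add fsupp_tmono fsupp_subset[OF fsupp_cop_red]) auto
next
  case (3 x y v)
  have IH: "cop (y # v) \<in> fsupp (pos_words \<times> pos_words)"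
    if "s \<in> supp (\<lambda>s. cop_letter x s - tmono [] [x] s)" for s
    using "3.IH"[OF that prod.collapse] "3.prems" by simp
  have 1: "s \<in> pos_words \<times> pos_words" if "s \<in> supp (cop_red x)" for s
    using fsuppD(2)[OF fsupp_cop_red that] by auto
  moreover have "s' \<in> pos_words \<times> pos_words" if "s \<in> supp (cop_red x)" "s' \<in> supp (cop (y # v))" for s s'
    using fsuppD(2)[OF IH that(2)] that(1) by (simp add: cop_letter_eq)
  ultimately show ?case unfolding cop_Cons_Cons using "3.prems"
    by (intro fsupp_add fsupp_sum fsupp_scale fsupp_tmono fsupp_tensor fsupp_mono fsupp_sh)
       (auto simp: mem_Times_iff)
qed

lemma tshE_alt: "tshE T1 T2 = (\<lambda>t. \<Sum>s\<in>supp T1. \<Sum>s'\<in>supp T2.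
     T1 s * T2 s' * tensor (sh (fst s) (fst s')) (sh (snd s) (snd s')) t)"
  by (simp add: tshE_def case_prod_unfold)

lemma fsupp_tshE:
  assumes "T1 \<in> fsupp (pos_words \<times> pos_words)" "T2 \<in> fsupp (pos_words \<times> pos_words)"
  shows "tshE T1 T2 \<in> fsupp (pos_words \<times> pos_words)"
  unfolding tshE_alt
  by (intro fsupp_sum fsupp_scale fsupp_tensor fsupp_sh)
     (use fsuppD(2)[OF assms(1)] fsuppD(2)[OF assms(2)] in \<open>auto simp: mem_Times_iff\<close>)

lemma wt_Cons [simp]: "wt (x # a) = fst x + wt a" and wt_Nil [simp]: "wt [] = 0"
  by (simp_all add: wt_def)

lemma wt_ge: "y \<in> set a \<Longrightarrow> fst y \<le> wt a"
  by (induction a) auto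

lemma length_le_wt: "a \<in> pos_words \<Longrightarrow> length a \<le> wt a"
  by (induction a) auto

text \<open>Positive weights bound the number of letters as well as the weight of each letter by
  \<open>n\<close>.\<close>

lemma finite_unit_words: "finite (unit_words n :: 'k::one word set)"
proof (rule finite_subset)
  show "unit_words n \<subseteq> {a :: 'k word. set a \<subseteq> {..n} \<times> {1} \<and> length a \<le> n}"
  proof
    fix a :: "'k word" assume a: "a \<in> unit_words n"
    then have "length a \<le> n"
      using length_le_wt[OF unit_words_pos[OF a]] by (simp add: unit_words_def)
    moreover have "set a \<subseteq> {..n} \<times> {1}"
      using a wt_ge[of _ a] by (auto simp: unit_words_def mem_Times_iff)
    ultimately show "a \<in> {a. set a \<subseteq> {..n} \<times> {1} \<and> length a \<le> n}" by simp
  qed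
  show "finite {a :: 'k word. set a \<subseteq> {..n} \<times> {1} \<and> length a \<le> n}"
    by (rule finite_lists_length_le) auto
qed

section \<open>Finite additive subgroups of an infinite field\<close>

lemma poly_eqI_infinite:
  fixes p q :: "'a::{comm_ring_1,ring_no_zero_divisors} poly"
  assumes "infinite (UNIV :: 'a set)" "\<And>x. poly p x = poly q x"
  shows "p = q"
proof (rule ccontr)
  assume "p \<noteq> q"
  then have "finite {x. poly (p - q) x = 0}" by (intro poly_roots_finite) simp
  then show False using assms by simp
qed

lemma degree_prod_linear:
  fixes g :: "'b \<Rightarrow> 'a::field"
  assumes "finite A"
  shows "degree (\<Prod>c\<in>A. [:g c, 1:]) = card A"
  by (subst degree_prod_eq_sum_degree) auto

lemma coeff_prod_linear:
  fixes g :: "'b \<Rightarrow> 'a::field"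
  assumes "finite A"
  shows "coeff (\<Prod>c\<in>A. [:g c, 1:]) (card A) = 1"
  using lead_coeff_prod[of "\<lambda>c. [:g c, 1:]" A] degree_prod_linear[OF assms, of g] by simp

text \<open>The expansion of \<open>1 / (b - X)\<close>.\<close>

definition geom :: "'a::field \<Rightarrow> 'a fps" where
  "geom b = Abs_fps (\<lambda>n. inverse b ^ Suc n)"

lemma geom_mult: "b \<noteq> 0 \<Longrightarrow> geom b * (fps_const b - fps_X) = 1"
proof (rule fps_ext)
  fix n assume "b \<noteq> 0"
  then show "(geom b * (fps_const b - fps_X)) $ n = 1 $ n"
    by (cases n) (simp_all add: geom_def right_diff_distrib fps_mult_right_const_nth)
qed

locale finite_subgroup =
  fixes U :: "'a::field set"
  assumes finite_U: "finite U"
    and zero_U: "0 \<in> U"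
    and diff_U: "\<And>x y. x \<in> U \<Longrightarrow> y \<in> U \<Longrightarrow> x - y \<in> U"
    and infinite_field: "infinite (UNIV :: 'a set)"
begin

lemma minus_U: "x \<in> U \<Longrightarrow> - x \<in> U"
  using diff_U[OF zero_U] by simp

lemma add_U: "x \<in> U \<Longrightarrow> y \<in> U \<Longrightarrow> x + y \<in> U"
  using diff_U[of x "- y"] minus_U by simp

text \<open>\<open>P\<close> is additive with kernel \<open>U\<close>; \<open>D\<close> is its derivative, so \<open>E\<close> is normalized to
  \<open>E(t) = t + \<dots>\<close>.\<close>

definition P :: "'a \<Rightarrow> 'a" where "P x = (\<Prod>c\<in>U. x - c)"
definition D :: "'a" where "D = (\<Prod>c\<in>U-{0}. - c)"
definition E :: "'a \<Rightarrow> 'a" where "E x = P x / D"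

lemma D_nz: "D \<noteq> 0"
  using finite_U by (simp add: D_def)

lemma P_eq_0_iff: "P x = 0 \<longleftrightarrow> x \<in> U"
  using finite_U by (auto simp: P_def)

lemma P_shift: "c \<in> U \<Longrightarrow> P (x + c) = P x"
  unfolding P_def
  by (rule prod.reindex_bij_witness[of _ "\<lambda>d. d + c" "\<lambda>d. d - c"])
     (auto intro: diff_U add_U)

definition pU :: "'a poly" where "pU = (\<Prod>c\<in>U. [:-c, 1:])"

lemma poly_pU: "poly pU x = P x"
  by (simp add: pU_def P_def poly_prod)

text \<open>As polynomials in \<open>x\<close> both sides are monic of degree \<open>card U\<close>,
  and they agree at the points of \<open>U\<close> because \<open>P\<close> is periodic there. Hence
  they are equal.\<close>

lemma P_add: "P (x + y) = P x + P y"
proof -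
  have "card U \<ge> 1" using finite_U zero_U by (auto simp: Suc_le_eq card_gt_0_iff)
  have "(\<Prod>c\<in>U. [:y - c, 1:]) = pU + [:P y:]"
  proof (rule poly_eqI_degree_lead_coeff[where A = U and n = "card U"])
    show "coeff (\<Prod>c\<in>U. [:y - c, 1:]) (card U) = coeff (pU + [:P y:]) (card U)"
      using \<open>card U \<ge> 1\<close> coeff_prod_linear[OF finite_U, of "\<lambda>c. y - c"]
        coeff_prod_linear[OF finite_U, of uminus]
      by (auto simp: pU_def coeff_pCons split: nat.split)
    show "degree (\<Prod>c\<in>U. [:y - c, 1:]) \<le> card U"
      by (simp add: degree_prod_linear[OF finite_U])
    show "degree (pU + [:P y:]) \<le> card U"
      unfolding pU_def by (intro degree_add_le) (simp_all add: degree_prod_linear[OF finite_U])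
    show "poly (\<Prod>c\<in>U. [:y - c, 1:]) z = poly (pU + [:P y:]) z" if "z \<in> U" for z
      using P_shift[OF that, of y] that P_eq_0_iff[of z]
      by (simp add: poly_prod poly_pU P_def algebra_simps)
  qed simp
  then have "poly (\<Prod>c\<in>U. [:y - c, 1:]) x = poly (pU + [:P y:]) x" by simp
  then show ?thesis by (simp add: poly_prod poly_pU P_def algebra_simps)
qed

lemma P_0: "P 0 = 0" using P_eq_0_iff zero_U by simp

lemma P_diff: "P (x - y) = P x - P y"
  using P_add[of "x - y" y] by simp

lemma E_add: "E (x + y) = E x + E y" by (simp add: E_def P_add add_divide_distrib)
lemma E_diff: "E (x - y) = E x - E y" by (simp add: E_def P_diff diff_divide_distrib)
lemma E_0: "E 0 = 0" by (simp add: E_def P_0)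
lemma E_eq_0_iff: "E x = 0 \<longleftrightarrow> x \<in> U" by (simp add: E_def P_eq_0_iff D_nz)
lemma E_eq_iff: "E x = E y \<longleftrightarrow> x - y \<in> U"
  using E_eq_0_iff[of "x - y"] by (simp add: E_diff)

text \<open>The fibres of \<open>E\<close> are cosets of the finite set \<open>U\<close>. The image
  has to be infinite so that flags inside it can separate words.\<close>

lemma infinite_range_E: "infinite (range E)"
proof
  assume "finite (range E)"
  then obtain a where "infinite {x \<in> UNIV. E x = E a}"
    using pigeonhole_infinite[OF infinite_field] by auto
  moreover have "{x \<in> UNIV. E x = E a} \<subseteq> (\<lambda>c. a + c) ` U"
    by (auto simp: E_eq_iff intro!: image_eqI[where x = "_ - a"])
  ultimately show False using finite_U finite_surj by blast
qed

text \<open>Multiplication by \<open>f\<close> permutes \<open>U - {0}\<close>; compare the product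
  \<open>D\<close> before and after.\<close>

lemma scale_pow:
  assumes f: "f \<noteq> 0" "\<And>x. x \<in> U \<Longrightarrow> f * x \<in> U" "\<And>x. x \<in> U \<Longrightarrow> inverse f * x \<in> U"
  shows "f ^ card (U - {0}) = 1"
proof -
  have "D = (\<Prod>c\<in>U-{0}. f * (- c))"
    unfolding D_def
    by (rule prod.reindex_bij_witness[of _ "\<lambda>c. f * c" "\<lambda>c. inverse f * c"])
       (use f in auto)
  also have "\<dots> = f ^ card (U - {0}) * D"
    by (simp add: D_def prod.distrib flip: prod_constant del: mult_minus_right)
  finally show ?thesis using D_nz by simp
qed

text \<open>\<open>P\<close> picks up the factor \<open>f ^ card U\<close>, which is
  \<open>f\<close> by \<open>scale_pow\<close>. This will make \<open>E\<close> linear over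
  F_q.\<close>

lemma E_scale:
  assumes f: "f \<noteq> 0" "\<And>x. x \<in> U \<Longrightarrow> f * x \<in> U" "\<And>x. x \<in> U \<Longrightarrow> inverse f * x \<in> U"
  shows "E (f * x) = f * E x"
proof -
  have "P (f * x) = (\<Prod>c\<in>U. f * (x - c))"
    unfolding P_def
    by (rule prod.reindex_bij_witness[of _ "\<lambda>c. f * c" "\<lambda>c. inverse f * c"])
       (use f in \<open>auto simp: algebra_simps\<close>)
  also have "\<dots> = f ^ card U * P x" by (simp add: P_def prod.distrib)
  also have "card U = Suc (card (U - {0}))" using finite_U zero_U by (metis card_Suc_Diff1)
  finally show ?thesis using scale_pow[OF f] by (simp add: E_def)
qed

text \<open>The left side is the derivative of \<open>P\<close> at \<open>x\<close>. Its degree is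
  below \<open>card U\<close>, and at a point \<open>z\<close> of \<open>U\<close> only the summand
  \<open>c = z\<close> survives, with value \<open>D\<close> after a translation; so it is
  constant.\<close>

lemma sum_prod_omit: "(\<Sum>c\<in>U. \<Prod>d\<in>U-{c}. x - d) = D"
proof -
  have "(\<Sum>c\<in>U. \<Prod>d\<in>U-{c}. [:- d, 1:]) = [:D:]"
  proof (rule poly_eqI_degree[where A = U])
    fix z assume z: "z \<in> U"
    have "poly (\<Sum>c\<in>U. \<Prod>d\<in>U-{c}. [:- d, 1:]) z = (\<Sum>c\<in>U. \<Prod>d\<in>U-{c}. z - d)"
      by (simp add: poly_sum poly_prod)
    also have "\<dots> = (\<Sum>c\<in>U. if c = z then \<Prod>d\<in>U-{z}. z - d else 0)"
      using finite_U z by (intro sum.cong) auto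
    also have "\<dots> = (\<Prod>d\<in>U-{z}. z - d)" using finite_U z by simp
    also have "\<dots> = D"
      unfolding D_def
      by (rule prod.reindex_bij_witness[of _ "\<lambda>d. z + d" "\<lambda>d. d - z"])
         (use z in \<open>auto intro: diff_U add_U\<close>)
    finally show "poly (\<Sum>c\<in>U. \<Prod>d\<in>U-{c}. [:- d, 1:]) z = poly [:D:] z" by simp
  next
    have "card (U - {c}) < card U" if "c \<in> U" for c
      using finite_U that by (metis card_Diff1_less)
    moreover have "card U > 0" using finite_U zero_U by (auto simp: card_gt_0_iff)
    ultimately show "degree (\<Sum>c\<in>U. \<Prod>d\<in>U-{c}. [:- d, 1:]) < card U"
      using finite_U by (intro degree_sum_less) (auto simp: degree_prod_linear)
    show "degree [:D:] < card U" using \<open>card U > 0\<close> by simp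
  qed
  then have "poly (\<Sum>c\<in>U. \<Prod>d\<in>U-{c}. [:- d, 1:]) x = D" by simp
  then show ?thesis by (simp add: poly_sum poly_prod)
qed

text \<open>The common denominator of \<open>\<Sum>c\<in>U. 1 / (a + c - X)\<close>; it equals
  \<open>P (a - X)\<close> because \<open>U\<close> is closed under negation. The next lemma gives
  the numerator.\<close>

lemma poly_reflect: "(\<Prod>c\<in>U. [:a + c, -1:]) = [:P a:] - pU"
proof (rule poly_eqI_infinite[OF infinite_field])
  fix x
  have "poly (\<Prod>c\<in>U. [:a + c, -1:]) x = (\<Prod>c\<in>U. (a - x) - c)"
    unfolding poly_prod
    by (rule prod.reindex_bij_witness[of _ uminus uminus]) (auto intro: minus_U)
  also have "\<dots> = P a - P x" by (simp add: P_diff flip: P_def)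
  finally show "poly (\<Prod>c\<in>U. [:a + c, -1:]) x = poly ([:P a:] - pU) x"
    by (simp add: poly_pU)
qed

lemma poly_reflect_omit: "(\<Sum>c\<in>U. \<Prod>d\<in>U-{c}. [:a + d, -1:]) = [:D:]"
proof (rule poly_eqI_infinite[OF infinite_field])
  fix x
  have "poly (\<Sum>c\<in>U. \<Prod>d\<in>U-{c}. [:a + d, -1:]) x = (\<Sum>c\<in>U. \<Prod>d\<in>U-{c}. (a - x) - (- d))"
    by (simp add: poly_sum poly_prod algebra_simps)
  also have "\<dots> = (\<Sum>c\<in>U. \<Prod>d\<in>U-{- c}. (a - x) - d)"
    by (intro sum.cong refl prod.reindex_bij_witness[of _ uminus uminus]) (auto intro: minus_U)
  also have "\<dots> = (\<Sum>c\<in>U. \<Prod>d\<in>U-{c}. (a - x) - d)"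
    by (rule sum.reindex_bij_witness[of _ uminus uminus]) (auto intro: minus_U)
  finally show "poly (\<Sum>c\<in>U. \<Prod>d\<in>U-{c}. [:a + d, -1:]) x = poly [:D:] x"
    by (simp add: sum_prod_omit)
qed

section \<open>Power sums over cosets by generating functions\<close>

definition fU :: "'a fps" where "fU = fps_of_poly pU"

text \<open>With this sign the numbers are the coefficients of \<open>t / E(t)\<close> in positive
  degree.\<close>

definition inv_sum :: "nat \<Rightarrow> 'a" where "inv_sum i = - (\<Sum>c\<in>U-{0}. inverse c ^ i)"

text \<open>The power series of \<open>t / E(t)\<close>, as \<open>G_fU\<close> confirms.\<close>

definition G :: "'a fps" where "G = Abs_fps (\<lambda>n. if n = 0 then 1 else inv_sum n)"

lemma fps_of_linear: "fps_of_poly [:b :: 'a, -1:] = fps_const b - fps_X"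
  by (rule fps_ext) (auto simp: coeff_pCons split: nat.split)

lemma fps_of_linear': "fps_of_poly [:- b :: 'a, 1:] = fps_X - fps_const b"
  by (rule fps_ext) (auto simp: coeff_pCons split: nat.split)

text \<open>With denominators cleared, this is
  \<open>\<Sum>c\<in>U. 1 / (a + c - t) = D / (P(a) - P(t))\<close>.\<close>

lemma geom_sum:
  assumes "a \<notin> U"
  shows "(\<Sum>c\<in>U. geom (a + c)) * (fps_const (P a) - fU) = fps_const D"
proof -
  have nz: "a + c \<noteq> 0" if "c \<in> U" for c
    using assms minus_U[OF that] by (auto simp: add_eq_0_iff2)
  have "fps_const (P a) - fU = fps_of_poly (\<Prod>c\<in>U. [:a + c, -1:])"
    by (simp add: poly_reflect fU_def fps_of_poly_diff fps_of_poly_const)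
  also have "\<dots> = (\<Prod>c\<in>U. fps_const (a + c) - fps_X)"
    by (simp add: fps_of_poly_prod fps_of_linear)
  finally have "(\<Sum>c\<in>U. geom (a + c)) * (fps_const (P a) - fU)
      = (\<Sum>c\<in>U. geom (a + c) * (\<Prod>d\<in>U. fps_const (a + d) - fps_X))"
    by (simp add: sum_distrib_right)
  also have "\<dots> = (\<Sum>c\<in>U. \<Prod>d\<in>U-{c}. fps_const (a + d) - fps_X)"
  proof (rule sum.cong[OF refl])
    fix c assume c: "c \<in> U"
    then show "geom (a + c) * (\<Prod>d\<in>U. fps_const (a + d) - fps_X)
        = (\<Prod>d\<in>U-{c}. fps_const (a + d) - fps_X)"
      using finite_U geom_mult[OF nz[OF c]]
      by (subst prod.remove[of _ c]) (simp_all flip: mult.assoc)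
  qed
  also have "\<dots> = fps_of_poly (\<Sum>c\<in>U. \<Prod>d\<in>U-{c}. [:a + d, -1:])"
    by (simp add: fps_of_poly_prod fps_of_poly_sum fps_of_linear)
  finally show ?thesis by (simp add: poly_reflect_omit fps_of_poly_const)
qed

lemma sum_prod_omit_fps: "(\<Sum>c\<in>U. \<Prod>d\<in>U-{c}. fps_X - fps_const d) = fps_const D"
proof -
  have "(\<Sum>c\<in>U. \<Prod>d\<in>U-{c}. [:- d, 1:]) = [:D:]"
    by (rule poly_eqI_infinite[OF infinite_field]) (simp add: poly_sum poly_prod sum_prod_omit)
  then have "fps_of_poly (\<Sum>c\<in>U. \<Prod>d\<in>U-{c}. [:- d, 1:]) = fps_const D"
    by (simp add: fps_of_poly_const)
  then show ?thesis by (simp add: fps_of_poly_prod fps_of_poly_sum fps_of_linear')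
qed

lemma fU_eq: "fU = (\<Prod>c\<in>U. fps_X - fps_const c)"
  by (simp add: fU_def pU_def fps_of_poly_prod fps_of_linear')

text \<open>\<open>G\<close> is \<open>t\<close> times the logarithmic derivative of
  \<open>P\<close>: in \<open>\<Sum>c\<in>U. t / (t - c)\<close> the summand \<open>c = 0\<close> is
  1 and the others are geometric series. Multiplying by \<open>P\<close> leaves \<open>t\<close>
  times the derivative, the constant \<open>D\<close>.\<close>

lemma G_fU: "G * fU = fps_const D * fps_X"
proof -
  have "G = 1 - (\<Sum>c\<in>U-{0}. fps_X * geom c)"
    by (rule fps_ext)
       (auto simp: G_def inv_sum_def geom_def fps_sum_nth simp flip: power_Suc)
  then have G: "G * fU = fU + (\<Sum>c\<in>U-{0}. fps_X * (- geom c * fU))"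
    by (simp add: ring_distribs sum_distrib_right sum_negf mult.assoc)
  have sum: "(\<Sum>c\<in>U-{0}. fps_X * (- geom c * fU))
      = (\<Sum>c\<in>U-{0}. fps_X * (\<Prod>d\<in>U-{c}. fps_X - fps_const d))"
  proof (rule sum.cong[OF refl])
    fix c assume c: "c \<in> U - {0}"
    have "- geom c * (fps_X - fps_const c) = 1"
      using geom_mult[of c] c by (simp add: algebra_simps)
    then show "fps_X * (- geom c * fU) = fps_X * (\<Prod>d\<in>U-{c}. fps_X - fps_const d)"
      unfolding fU_eq using finite_U c
      by (subst prod.remove[of _ c]) (auto simp: mult.assoc[symmetric] simp del: mult_minus_left)
  qed
  have fU: "fU = fps_X * (\<Prod>d\<in>U-{0}. fps_X - fps_const d)"
    unfolding fU_eq using finite_U zero_U by (subst prod.remove[of _ 0]) auto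
  have "G * fU = fps_X * (\<Prod>d\<in>U-{0}. fps_X - fps_const d)
      + (\<Sum>c\<in>U-{0}. fps_X * (\<Prod>d\<in>U-{c}. fps_X - fps_const d))"
    unfolding G sum by (simp only: fU[symmetric])
  also have "\<dots> = fps_X * (\<Sum>c\<in>U. \<Prod>d\<in>U-{c}. fps_X - fps_const d)"
    unfolding sum_distrib_left using finite_U zero_U by (subst sum.remove[of _ 0]) auto
  finally show ?thesis by (simp only: sum_prod_omit_fps mult.commute)
qed

text \<open>Compare the coefficients of \<open>t^(n-1)\<close> in
  \<open>1 / (E(a) - E(t)) = \<Sum>r. E(a)^(-r-1) E(t)^r\<close>, where
  \<open>E(t)^r = t^r H(r)\<close>. The family \<open>H\<close> of inverse powers of
  \<open>G\<close> is left abstract here; \<open>inv_G_power\<close> will be an explicit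
  one.\<close>

lemma coset_power_sum:
  assumes a: "a \<notin> U" and n: "n \<ge> 1" and H: "\<And>s. H s * G ^ s = 1"
  shows "(\<Sum>c\<in>U. inverse (a + c) ^ n) = (\<Sum>r=1..n. inverse (E a) ^ r * H (r - 1) $ (n - r))"
proof -
  define e where "e = fps_const (inverse D) * fU"
  define F where "F = (\<Sum>c\<in>U. geom (a + c))"
  define x where "x = inverse (E a)"
  have Pa: "P a \<noteq> 0" using a P_eq_0_iff by simp
  have Ge: "e * G = fps_X"
  proof -
    have "e * G = fps_const (inverse D) * (G * fU)" by (simp add: e_def mult_ac)
    also have "\<dots> = fps_const (inverse D) * fps_const D * fps_X"
      by (simp only: G_fU mult.assoc)
    finally show ?thesis using D_nz by simp
  qed
  have e_pow: "e ^ s = fps_X ^ s * H s" for s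
  proof -
    have "e ^ s = e ^ s * (H s * G ^ s)" by (simp add: H)
    also have "\<dots> = (e * G) ^ s * H s" by (simp add: power_mult_distrib mult_ac)
    finally show ?thesis by (simp add: Ge)
  qed
  have "fps_const (inverse (P a)) * (F * (fps_const (P a) - fU)) = fps_const (inverse (P a) * D)"
    using geom_sum[OF a] by (simp add: F_def)
  moreover have "fps_const (inverse (P a)) * (F * (fps_const (P a) - fU))
     = F - fps_const x * e * F"
  proof -
    have "fps_const (inverse (P a)) * (F * (fps_const (P a) - fU))
      = (fps_const (inverse (P a)) * fps_const (P a)) * F - fps_const (inverse (P a)) * fU * F"
      by (simp only: right_diff_distrib left_diff_distrib mult_ac)
    also have "fps_const (inverse (P a)) * fU = fps_const x * e"
      using D_nz by (simp add: x_def E_def e_def divide_inverse flip: mult.assoc)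
    finally show ?thesis using Pa by simp
  qed
  ultimately have rec: "F = fps_const x + fps_const x * e * F"
    by (simp add: x_def E_def field_simps)
  \<comment> \<open>The geometric series, truncated with its remainder. For \<open>N = n\<close> the
    remainder is divisible by \<open>fps_X ^ n\<close> and does not reach the coefficient
    \<open>n - 1\<close>.\<close>
  have iter: "F = (\<Sum>r<N. fps_const x * (fps_const x * e) ^ r) + (fps_const x * e) ^ N * F" for N
  proof (induction N)
    case (Suc N)
    have "(fps_const x * e) ^ N * F = (fps_const x * e) ^ N * (fps_const x + fps_const x * e * F)"
      by (simp flip: rec)
    also have "\<dots> = fps_const x * (fps_const x * e) ^ N + (fps_const x * e) ^ Suc N * F"
      by (simp add: algebra_simps)
    finally show ?case using Suc.IH by (simp add: add.assoc)
  qed simp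
  have shift: "fps_const x * (fps_const x * e) ^ r = fps_const (x ^ Suc r) * (fps_X ^ r * H r)" for r
    by (simp add: power_mult_distrib e_pow fps_const_power mult.assoc flip: fps_const_mult)
  have "(\<Sum>c\<in>U. inverse (a + c) ^ n) = F $ (n - 1)"
    using n by (simp add: F_def geom_def fps_sum_nth del: power_Suc)
  also have "\<dots> = (\<Sum>r<n. x ^ Suc r * (fps_X ^ r * H r) $ (n - 1))
      + ((fps_const x * e) ^ n * F) $ (n - 1)"
    by (subst iter[of n]) (simp add: fps_sum_nth shift del: power_Suc)
  also have "(fps_const x * e) ^ n * F = fps_X ^ n * (fps_const (x ^ n) * H n * F)"
    by (simp add: power_mult_distrib e_pow fps_const_power mult_ac)
  also have "\<dots> $ (n - 1) = 0"
    using n by (simp add: fps_X_power_mult_nth)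
  also have "(\<Sum>r<n. x ^ Suc r * (fps_X ^ r * H r) $ (n - 1))
      = (\<Sum>r<n. x ^ Suc r * H r $ (n - 1 - r))"
    by (intro sum.cong) (auto simp: fps_X_power_mult_nth)
  also have "\<dots> = (\<Sum>r=1..n. x ^ r * H (r - 1) $ (n - r))"
    by (rule sum.reindex_bij_witness[of _ "\<lambda>r. r - 1" Suc]) auto
  finally show ?thesis by (simp add: x_def)
qed

end

section \<open>Partial fractions\<close>

text \<open>The polar part at \<open>A = 0\<close> of \<open>A^(-a) * (A - c)^(-b)\<close>. At
  \<open>b = l = 0\<close> natural subtraction gives \<open>0 choose 0 = 1\<close>, the desired
  value.\<close>

definition pfrac :: "'a::field \<Rightarrow> 'a \<Rightarrow> nat \<Rightarrow> nat \<Rightarrow> 'a" where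
  "pfrac A c a b =
     (\<Sum>l<a. (-1) ^ b * of_nat (b + l - 1 choose l) * inverse c ^ (b + l) * inverse A ^ (a - l))"

lemma pfrac_0_left [simp]: "pfrac A c 0 b = 0"
  by (simp add: pfrac_def)

lemma pfrac_0_right: "a > 0 \<Longrightarrow> pfrac A c a 0 = inverse A ^ a"
  unfolding pfrac_def
  by (cases a) (simp_all add: sum.lessThan_Suc_shift binomial_eq_0 del: sum.lessThan_Suc)

lemma pfrac_Suc_Suc:
  "pfrac A c (Suc a) (Suc b) = (pfrac A c a (Suc b) - pfrac A c (Suc a) b) * inverse c"
proof -
  define t where "t l = inverse c ^ Suc (Suc (b + l)) * inverse A ^ (a - l)" for l
  have 1: "pfrac A c (Suc a) (Suc b) = (-1) ^ Suc b * inverse c ^ Suc b * inverse A ^ Suc a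
      + (\<Sum>l<a. (-1) ^ Suc b * of_nat (Suc (b + l) choose Suc l) * t l)"
    unfolding pfrac_def by (subst sum.lessThan_Suc_shift) (simp add: t_def mult.assoc)
  have 2: "pfrac A c (Suc a) b * inverse c = (-1) ^ b * inverse c ^ Suc b * inverse A ^ Suc a
      + (\<Sum>l<a. (-1) ^ b * of_nat (b + l choose Suc l) * t l)"
    unfolding pfrac_def sum_distrib_right
    by (subst sum.lessThan_Suc_shift) (simp add: t_def mult_ac)
  have 3: "pfrac A c a (Suc b) * inverse c = (\<Sum>l<a. (-1) ^ Suc b * of_nat (b + l choose l) * t l)"
    unfolding pfrac_def sum_distrib_right by (simp add: t_def mult_ac)
  have "(\<Sum>l<a. (-1) ^ Suc b * of_nat (Suc (b + l) choose Suc l) * t l)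
     = (\<Sum>l<a. (-1) ^ Suc b * of_nat (b + l choose l) * t l)
       - (\<Sum>l<a. (-1) ^ b * of_nat (b + l choose Suc l) * t l)"
    unfolding sum_subtractf[symmetric] by (intro sum.cong) (simp_all add: algebra_simps)
  then show ?thesis by (simp add: 1 2 3 left_diff_distrib)
qed

text \<open>The identity \<open>1 / (A B) = (1 / B - 1 / A) / c\<close> lowers one of the exponents,
  and by Pascal's rule \<open>pfrac\<close> obeys the same recursion.\<close>

lemma partial_fractions:
  fixes A B c :: "'a::field"
  assumes "A \<noteq> 0" "B \<noteq> 0" "c \<noteq> 0" "A = B + c" "a + b > 0"
  shows "inverse A ^ a * inverse B ^ b = pfrac A c a b + pfrac B (- c) b a"
  using assms(5)
proof (induction "a + b" arbitrary: a b rule: less_induct)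
  case less
  show ?case
  proof (cases "a = 0 \<or> b = 0")
    case True
    then show ?thesis using less.prems by (auto simp: pfrac_0_right)
  next
    case False
    then obtain a' b' where ab: "a = Suc a'" "b = Suc b'" by (metis not0_implies_Suc)
    have "inverse A ^ a * inverse B ^ b
        = inverse A ^ a' * inverse B ^ b' * (inverse A * inverse B)"
      by (simp add: ab)
    also have "inverse A * inverse B = (inverse B - inverse A) * inverse c"
      using assms(1-4) by (simp add: field_simps)
    also have "inverse A ^ a' * inverse B ^ b' * \<dots>
        = (inverse A ^ a' * inverse B ^ b - inverse A ^ a * inverse B ^ b') * inverse c"
      by (simp add: ab algebra_simps)
    also have "inverse A ^ a' * inverse B ^ b = pfrac A c a' b + pfrac B (- c) b a'"
      by (rule less.hyps) (simp_all add: ab)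
    also have "inverse A ^ a * inverse B ^ b' = pfrac A c a b' + pfrac B (- c) b' a"
      by (rule less.hyps) (simp_all add: ab)
    finally show ?thesis
      by (simp add: ab pfrac_Suc_Suc algebra_simps)
  qed
qed

context finite_subgroup
begin

lemma coset_sum_pfrac:
  assumes "b \<ge> 1"
  shows "(\<Sum>x\<in>U. \<Sum>c\<in>U-{0}. pfrac (v + x) c a b)
    = (\<Sum>i=1..<a+b. (-1) ^ (b - 1) * of_nat (a + b - i - 1 choose (b - 1)) * inv_sum (a + b - i)
        * (\<Sum>x\<in>U. inverse (v + x) ^ i))"
    (is "_ = (\<Sum>i=1..<a+b. ?t i)")
proof -
  have "(\<Sum>x\<in>U. \<Sum>c\<in>U-{0}. pfrac (v + x) c a b)
    = (\<Sum>l<a. \<Sum>x\<in>U. \<Sum>c\<in>U-{0}. (-1) ^ b * of_nat (b + l - 1 choose l)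
         * inverse c ^ (b + l) * inverse (v + x) ^ (a - l))"
  proof -
    have "(\<Sum>c\<in>U-{0}. pfrac (v + x) c a b) = (\<Sum>l<a. \<Sum>c\<in>U-{0}.
        (-1) ^ b * of_nat (b + l - 1 choose l) * inverse c ^ (b + l) * inverse (v + x) ^ (a - l))" for x
      unfolding pfrac_def by (rule sum.swap)
    then show ?thesis by (simp only:) (rule sum.swap)
  qed
  also have "\<dots> = (\<Sum>l<a. ?t (a - l))"
  proof (rule sum.cong[OF refl])
    fix l assume l: "l \<in> {..<a}"
    have "(\<Sum>x\<in>U. \<Sum>c\<in>U-{0}. (-1) ^ b * of_nat (b + l - 1 choose l)
         * inverse c ^ (b + l) * inverse (v + x) ^ (a - l))
       = (-1) ^ b * of_nat (b + l - 1 choose l) * (\<Sum>c\<in>U-{0}. inverse c ^ (b + l))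
         * (\<Sum>x\<in>U. inverse (v + x) ^ (a - l))"
      by (simp add: sum_distrib_left sum_distrib_right mult.assoc)
    also have "(\<Sum>c\<in>U-{0}. inverse c ^ (b + l)) = - inv_sum (b + l)"
      by (simp add: inv_sum_def)
    also have "a + b - (a - l) = b + l" using l by auto
    moreover have "b + l - 1 choose l = (b + l - 1 choose (b - 1))"
      using assms by (subst binomial_symmetric) auto
    moreover have "(-1) ^ b = - ((-1 :: 'a) ^ (b - 1))" using assms by (cases b) auto
    ultimately show "(\<Sum>x\<in>U. \<Sum>c\<in>U-{0}. (-1) ^ b * of_nat (b + l - 1 choose l)
         * inverse c ^ (b + l) * inverse (v + x) ^ (a - l)) = ?t (a - l)"
      by simp
  qed
  also have "\<dots> = (\<Sum>i=1..a. ?t i)"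
    by (rule sum.reindex_bij_witness[of _ "\<lambda>i. a - i" "\<lambda>l. a - l"]) auto
  \<comment> \<open>The binomial coefficient vanishes for \<open>i > a\<close>, so the sum can take
    the range used in the diamond product.\<close>
  also have "\<dots> = (\<Sum>i=1..<a+b. ?t i)"
    using assms by (intro sum.mono_neutral_left) (auto simp: binomial_eq_0)
  finally show ?thesis .
qed

text \<open>Write pairs of elements of \<open>U\<close> as \<open>(x, x - c)\<close>. The diagonal
  \<open>c = 0\<close> gives exponent \<open>a + b\<close>. For \<open>c \<noteq> 0\<close> use
  partial fractions; translating \<open>x\<close> and then replacing \<open>c\<close> by
  \<open>-c\<close> brings the polar parts of the second factor to the form of the first.\<close>

lemma coset_sum_mult:
  assumes v: "v \<notin> U" and ab: "a \<ge> 1" "b \<ge> 1"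
  shows "(\<Sum>x\<in>U. inverse (v + x) ^ a) * (\<Sum>x\<in>U. inverse (v + x) ^ b)
    = (\<Sum>x\<in>U. inverse (v + x) ^ (a + b))
      + (\<Sum>i=1..<a+b. ((-1) ^ (a - 1) * of_nat (a + b - i - 1 choose (a - 1))
          + (-1) ^ (b - 1) * of_nat (a + b - i - 1 choose (b - 1)))
          * inv_sum (a + b - i) * (\<Sum>x\<in>U. inverse (v + x) ^ i))"
proof -
  have nz: "v + x \<noteq> 0" if "x \<in> U" for x
    using v minus_U[OF that] by (auto simp: add_eq_0_iff2)
  have "(\<Sum>x\<in>U. inverse (v + x) ^ a) * (\<Sum>x\<in>U. inverse (v + x) ^ b)
    = (\<Sum>x\<in>U. \<Sum>z\<in>U. inverse (v + x) ^ a * inverse (v + z) ^ b)"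
    by (simp add: sum_product)
  also have "\<dots> = (\<Sum>x\<in>U. \<Sum>c\<in>U. inverse (v + x) ^ a * inverse (v + (x - c)) ^ b)"
    by (intro sum.cong refl sum.reindex_bij_witness[of _ "\<lambda>c. _ - c" "\<lambda>z. _ - z"])
       (auto intro: diff_U)
  also have "\<dots> = (\<Sum>x\<in>U. inverse (v + x) ^ (a + b)
      + (\<Sum>c\<in>U-{0}. inverse (v + x) ^ a * inverse (v + (x - c)) ^ b))"
    using finite_U zero_U by (intro sum.cong refl) (simp add: sum.remove[of _ 0] power_add)
  also have "\<dots> = (\<Sum>x\<in>U. inverse (v + x) ^ (a + b)
      + (\<Sum>c\<in>U-{0}. pfrac (v + x) c a b + pfrac (v + (x - c)) (- c) b a))"
  proof (intro sum.cong refl arg_cong2[of _ _ _ _ "(+)"])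
    fix x c assume "x \<in> U" "c \<in> U - {0}"
    then show "inverse (v + x) ^ a * inverse (v + (x - c)) ^ b
        = pfrac (v + x) c a b + pfrac (v + (x - c)) (- c) b a"
      using ab nz[of x] nz[of "x - c"] diff_U[of x c]
      by (intro partial_fractions) auto
  qed
  also have "\<dots> = (\<Sum>x\<in>U. inverse (v + x) ^ (a + b))
      + ((\<Sum>x\<in>U. \<Sum>c\<in>U-{0}. pfrac (v + x) c a b)
        + (\<Sum>x\<in>U. \<Sum>c\<in>U-{0}. pfrac (v + (x - c)) (- c) b a))"
    by (simp add: sum.distrib)
  also have "(\<Sum>x\<in>U. \<Sum>c\<in>U-{0}. pfrac (v + (x - c)) (- c) b a)
      = (\<Sum>c\<in>U-{0}. \<Sum>x\<in>U. pfrac (v + (x - c)) (- c) b a)"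
    by (rule sum.swap)
  also have "\<dots> = (\<Sum>c\<in>U-{0}. \<Sum>x\<in>U. pfrac (v + x) (- c) b a)"
    by (intro sum.cong refl sum.reindex_bij_witness[of _ "\<lambda>x. x + _" "\<lambda>x. x - _"])
       (auto intro: diff_U add_U)
  also have "\<dots> = (\<Sum>c\<in>U-{0}. \<Sum>x\<in>U. pfrac (v + x) c b a)"
    by (rule sum.reindex_bij_witness[of _ uminus uminus]) (auto intro: minus_U)
  also have "\<dots> = (\<Sum>x\<in>U. \<Sum>c\<in>U-{0}. pfrac (v + x) c b a)"
    by (rule sum.swap)
  also have "(\<Sum>x\<in>U. \<Sum>c\<in>U-{0}. pfrac (v + x) c a b) + \<dots>
     = (\<Sum>i=1..<a+b. ((-1) ^ (a - 1) * of_nat (a + b - i - 1 choose (a - 1))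
          + (-1) ^ (b - 1) * of_nat (a + b - i - 1 choose (b - 1)))
          * inv_sum (a + b - i) * (\<Sum>x\<in>U. inverse (v + x) ^ i))"
    unfolding coset_sum_pfrac[OF ab(1)] coset_sum_pfrac[OF ab(2)]
    by (simp add: add.commute[of b a] ring_distribs sum.distrib)
  finally show ?thesis .
qed

end

section \<open>Power sums over a finite field\<close>

lemma finite_field_power_card_minus_1:
  fixes f :: "'k::{field,finite}"
  assumes "f \<noteq> 0"
  shows "f ^ (card (UNIV :: 'k set) - 1) = 1"
proof -
  have "(\<Prod>c\<in>UNIV-{0}. c) = (\<Prod>c\<in>UNIV-{0}. f * c)"
    by (rule prod.reindex_bij_witness[of _ "\<lambda>c. f * c" "\<lambda>c. inverse f * c"]) (use assms in auto)
  also have "\<dots> = f ^ (card (UNIV :: 'k set) - 1) * (\<Prod>c\<in>UNIV-{0}. c)"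
    by (simp add: prod.distrib)
  finally show ?thesis by simp
qed

lemma of_nat_card_finite_field: "of_nat (card (UNIV :: 'k set)) = (0 :: 'k::{field,finite})"
proof -
  have "(\<Sum>x\<in>UNIV. x) = (\<Sum>x\<in>UNIV. x + 1 :: 'k)"
    by (rule sum.reindex_bij_witness[of _ "\<lambda>x. x + 1" "\<lambda>x. x - 1"]) auto
  then show ?thesis by (simp add: sum.distrib)
qed

text \<open>If \<open>q - 1\<close> does not divide \<open>j\<close>, some \<open>g\<close> has
  \<open>g ^ j \<noteq> 1\<close>, since \<open>X^r - 1\<close> with
  \<open>r = j mod (q - 1)\<close> has fewer than \<open>q - 1\<close> roots. Scaling by
  \<open>g\<close> multiplies the sum by a factor other than 1, so the sum is 0.\<close>

lemma sum_inverse_power_finite_field: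
  "(\<Sum>f\<in>UNIV-{0}. inverse f ^ j)
     = (if (card (UNIV :: 'k set) - 1) dvd j then -1 else (0 :: 'k::{field,finite}))"
proof -
  let ?q = "card (UNIV :: 'k set)"
  have q: "?q > 0" by (simp add: finite_UNIV_card_ge_0)
  show ?thesis
  proof (cases "(?q - 1) dvd j")
    case True
    then obtain m where "j = (?q - 1) * m" ..
    then have "(\<Sum>f\<in>UNIV-{0}. inverse f ^ j) = (\<Sum>f\<in>UNIV-{0::'k}. 1 :: 'k)"
      by (intro sum.cong refl) (simp add: power_mult finite_field_power_card_minus_1[simplified])
    also have "\<dots> = -1"
      using q of_nat_card_finite_field[where 'k = 'k] by (simp add: of_nat_diff Suc_leI)
    finally show ?thesis using True by simp
  next
    case False
    define r where "r = j mod (?q - 1)"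
    have "r > 0" using False by (simp add: r_def dvd_eq_mod_eq_0)
    have "?q - 1 > 0"
    proof (rule ccontr)
      assume "\<not> ?thesis"
      moreover have "card {0, 1 :: 'k} \<le> ?q" by (intro card_mono) auto
      ultimately show False by simp
    qed
    then have "r < ?q - 1" by (simp add: r_def)
    have "\<exists>g :: 'k. g \<noteq> 0 \<and> g ^ j \<noteq> 1"
    proof (rule ccontr)
      assume "\<not> ?thesis"
      then have all: "g ^ j = 1" if "g \<noteq> 0" for g :: 'k using that by blast
      have "g ^ r = 1" if "g \<noteq> 0" for g :: 'k
      proof -
        have "g ^ j = (g ^ (?q - 1)) ^ (j div (?q - 1)) * g ^ r"
          by (simp add: r_def flip: power_mult power_add)
        then show ?thesis using all[OF that] finite_field_power_card_minus_1[OF that] by simp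
      qed
      then have "UNIV - {0} \<subseteq> {x :: 'k. poly (monom 1 r - 1) x = 0}"
        by (auto simp: poly_monom)
      then have "card (UNIV - {0 :: 'k}) \<le> card {x :: 'k. poly (monom 1 r - 1) x = 0}"
        by (intro card_mono) auto
      also have "\<dots> \<le> degree (monom 1 r - 1 :: 'k poly)"
      proof (rule card_poly_roots_bound)
        have "coeff (monom 1 r - 1 :: 'k poly) r = 1" using \<open>r > 0\<close> by simp
        then show "monom 1 r - 1 \<noteq> (0 :: 'k poly)" by (metis coeff_0 zero_neq_one)
      qed
      also have "\<dots> \<le> r"
        by (intro degree_diff_le) (simp_all add: degree_monom_le)
      finally show False using \<open>r < ?q - 1\<close> by simp
    qed
    then obtain g :: 'k where g: "g \<noteq> 0" "g ^ j \<noteq> 1" by blast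
    have "(\<Sum>f\<in>UNIV-{0::'k}. inverse f ^ j) = (\<Sum>f\<in>UNIV-{0}. inverse (g * f) ^ j)"
      by (rule sum.reindex_bij_witness[of _ "\<lambda>c. g * c" "\<lambda>c. inverse g * c"])
         (use g in \<open>auto simp: mult.assoc[symmetric]\<close>)
    also have "\<dots> = inverse (g ^ j) * (\<Sum>f\<in>UNIV-{0}. inverse f ^ j)"
      by (simp add: sum_distrib_left power_mult_distrib power_inverse)
    finally have "(inverse (g ^ j) - 1) * (\<Sum>f\<in>UNIV-{0::'k}. inverse f ^ j) = 0"
      by (simp add: left_diff_distrib)
    then have "(\<Sum>f\<in>UNIV-{0::'k}. inverse f ^ j) = 0" using g by auto
    then show ?thesis using False by simp
  qed
qed

section \<open>Realization by power sums over flags\<close>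

locale field_embedding =
  fixes emb :: "'k::{field,finite} \<Rightarrow> 'K::field"
  assumes emb_add: "emb (x + y) = emb x + emb y"
    and emb_mult: "emb (x * y) = emb x * emb y"
    and emb_1 [simp]: "emb 1 = 1"
    and infinite_K: "infinite (UNIV :: 'K set)"
begin

lemma emb_0 [simp]: "emb 0 = 0"
proof -
  have "emb 0 + emb 0 = emb 0 + 0" by (simp flip: emb_add)
  then show ?thesis by (simp only: add_left_cancel)
qed

lemma emb_minus: "emb (- x) = - emb x"
  using emb_add[of x "- x"] by (simp add: eq_neg_iff_add_eq_0 add.commute)

lemma emb_diff: "emb (x - y) = emb x - emb y"
  using emb_add[of x "- y"] by (simp add: emb_minus)

lemma emb_sum: "emb (sum f A) = (\<Sum>i\<in>A. emb (f i))"
  by (induction A rule: infinite_finite_induct) (simp_all add: emb_add)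

lemma emb_power: "emb (x ^ n) = emb x ^ n"
  by (induction n) (simp_all add: emb_mult)

lemma emb_of_nat: "emb (of_nat n) = of_nat n"
  by (induction n) (simp_all add: emb_add)

lemma emb_eq_0_iff [simp]: "emb x = 0 \<longleftrightarrow> x = 0"
proof
  assume "emb x = 0"
  then have "emb (x * inverse x) = 0" by (simp add: emb_mult)
  then show "x = 0" by (cases "x = 0") auto
qed simp

lemma emb_inverse: "emb (inverse x) = inverse (emb x)"
proof (cases "x = 0")
  case False
  then have "emb x * emb (inverse x) = 1" by (simp flip: emb_mult)
  then show ?thesis by (simp add: inverse_unique)
qed simp

lemma emb_eq_iff: "emb x = emb z \<longleftrightarrow> x = z"
  using emb_eq_0_iff[of "x - z"] by (simp add: emb_diff)

section \<open>Linear extension of evaluations\<close>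

definition lsum :: "('a \<Rightarrow> 'K) \<Rightarrow> ('a \<Rightarrow> 'k) \<Rightarrow> 'K" where
  "lsum \<phi> p = (\<Sum>w\<in>supp p. emb (p w) * \<phi> w)"

lemma lsum_superset:
  assumes "finite A" "supp p \<subseteq> A"
  shows "lsum \<phi> p = (\<Sum>w\<in>A. emb (p w) * \<phi> w)"
  unfolding lsum_def using assms by (intro sum.mono_neutral_left) (auto simp: supp_def)

lemma lsum_add:
  assumes "p \<in> fsupp A" "r \<in> fsupp A"
  shows "lsum \<phi> (\<lambda>v. p v + r v) = lsum \<phi> p + lsum \<phi> r"
proof -
  have "finite (supp p \<union> supp r)" using assms by (auto simp: fsupp_def)
  moreover have "supp (\<lambda>v. p v + r v) \<subseteq> supp p \<union> supp r" by (auto simp: supp_def)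
  ultimately show ?thesis
    by (simp add: lsum_superset[where A = "supp p \<union> supp r"] emb_add ring_distribs sum.distrib)
qed

lemma lsum_scale: "lsum \<phi> (\<lambda>v. c * p v) = emb c * lsum \<phi> p"
proof (cases "c = 0")
  case False
  then have "supp (\<lambda>v. c * p v) = supp p" by (auto simp: supp_def)
  then show ?thesis by (simp add: lsum_def emb_mult sum_distrib_left mult.assoc)
qed (simp add: lsum_def)

lemma lsum_zero [simp]: "lsum \<phi> (\<lambda>_. 0) = 0"
  by (simp add: lsum_def)

lemma lsum_diff:
  assumes "p \<in> fsupp A" "r \<in> fsupp A"
  shows "lsum \<phi> (\<lambda>v. p v - r v) = lsum \<phi> p - lsum \<phi> r"
  using lsum_add[OF assms(1) fsupp_scale[OF assms(2)], of \<phi> "-1"] lsum_scale[of \<phi> "-1" r]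
  by (simp add: emb_minus)

lemma lsum_sum:
  assumes "\<And>i. i \<in> I \<Longrightarrow> f i \<in> fsupp A"
  shows "lsum \<phi> (\<lambda>v. \<Sum>i\<in>I. f i v) = (\<Sum>i\<in>I. lsum \<phi> (f i))"
  using assms
proof (induction I rule: infinite_finite_induct)
  case (insert i I)
  then show ?case
    using lsum_add[OF _ fsupp_sum, of "f i" A I f \<phi>] by simp
qed simp_all

lemma lsum_mono [simp]: "lsum \<phi> (mono w) = \<phi> w"
proof -
  have "supp (mono w :: 'k elem) = {w}" by (auto simp: supp_def mono_def)
  then show ?thesis by (simp add: lsum_def mono_def)
qed

lemma lsum_cong:
  assumes "p \<in> fsupp A" "\<And>w. w \<in> A \<Longrightarrow> \<phi> w = \<psi> w"
  shows "lsum \<phi> p = lsum \<psi> p"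
  unfolding lsum_def using assms by (intro sum.cong) (auto dest: fsuppD)

lemma lsum_fun_zero [simp]: "lsum (\<lambda>_. 0) p = 0"
  by (simp add: lsum_def)

lemma lsum_fun_add: "lsum (\<lambda>w. \<phi> w + \<psi> w) p = lsum \<phi> p + lsum \<psi> p"
  by (simp add: lsum_def ring_distribs sum.distrib)

lemma lsum_fun_scale: "lsum (\<lambda>w. c * \<phi> w) p = c * lsum \<phi> p"
  by (simp add: lsum_def sum_distrib_left mult.left_commute)

lemma lsum_fun_scale_right: "lsum (\<lambda>w. \<phi> w * c) p = lsum \<phi> p * c"
  by (simp add: lsum_def sum_distrib_right mult.assoc)

lemma lsum_lin:
  assumes "p \<in> fsupp B" "\<And>w. w \<in> B \<Longrightarrow> f w \<in> fsupp A"
  shows "lsum \<phi> (lin f p) = lsum (\<lambda>w. lsum \<phi> (f w)) p"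
proof -
  have "lsum \<phi> (lin f p) = (\<Sum>w\<in>supp p. lsum \<phi> (\<lambda>v. p w * f w v))"
    unfolding lin_def using assms by (intro lsum_sum[where A = A] fsupp_scale) (auto dest: fsuppD)
  then show ?thesis by (simp add: lsum_scale) (simp add: lsum_def)
qed

lemma lsum_bilin:
  assumes "p \<in> fsupp B" "r \<in> fsupp C" "\<And>w u. w \<in> B \<Longrightarrow> u \<in> C \<Longrightarrow> f w u \<in> fsupp A"
  shows "lsum \<phi> (bilin f p r) = lsum (\<lambda>w. lsum (\<lambda>u. lsum \<phi> (f w u)) r) p"
proof -
  have f: "f w u \<in> fsupp A" if "w \<in> supp p" "u \<in> supp r" for w u
    using assms that by (auto dest: fsuppD)
  have "lsum \<phi> (bilin f p r) = (\<Sum>w\<in>supp p. lsum \<phi> (\<lambda>v. \<Sum>u\<in>supp r. p w * r u * f w u v))"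
    unfolding bilin_def by (intro lsum_sum[where A = A] fsupp_sum fsupp_scale f)
  also have "\<dots> = (\<Sum>w\<in>supp p. \<Sum>u\<in>supp r. lsum \<phi> (\<lambda>v. p w * r u * f w u v))"
    by (intro sum.cong refl lsum_sum[where A = A] fsupp_scale f)
  finally show ?thesis
    by (simp add: lsum_scale emb_mult) (simp add: lsum_def sum_distrib_left mult.assoc)
qed

lemma lsum_lcons: "p \<in> fsupp A \<Longrightarrow> lsum \<phi> (lcons x p) = lsum (\<lambda>w. \<phi> (x # w)) p"
  unfolding lcons_def by (subst lsum_lin[where B = A and A = UNIV]) (auto intro: fsupp_mono)

lemma lsum_tensor:
  assumes "p \<in> fsupp A" "r \<in> fsupp B"
  shows "lsum \<phi> (tensor p r) = lsum (\<lambda>a. lsum (\<lambda>b. \<phi> (a, b)) r) p"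
proof -
  have "lsum \<phi> (tensor p r) = (\<Sum>(a, b)\<in>supp p \<times> supp r. emb (p a * r b) * \<phi> (a, b))"
    using assms
    by (subst lsum_superset[where A = "supp p \<times> supp r"])
       (auto simp: fsupp_def supp_def tensor_def intro!: sum.cong)
  then show ?thesis
    by (simp add: lsum_def sum_distrib_left mult_ac emb_mult sum.cartesian_product)
qed

section \<open>Flags and the values of words\<close>

text \<open>In an entry \<open>(v, k)\<close> the number \<open>k\<close> is the exponent to which
  characters are raised at the level of \<open>v\<close>.\<close>

fun span_of :: "('K \<times> nat) list \<Rightarrow> 'K set" where
  "span_of [] = {0}"
| "span_of ((v, k) # F) = (\<lambda>(f, c). emb f * v + c) ` (UNIV \<times> span_of F)"

fun flag :: "('K \<times> nat) list \<Rightarrow> bool" where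
  "flag [] \<longleftrightarrow> True"
| "flag ((v, k) # F) \<longleftrightarrow> v \<notin> span_of F \<and> flag F"

definition level :: "('K \<times> nat) list \<Rightarrow> 'K \<Rightarrow> nat \<Rightarrow> 'K" where
  "level F v n = (\<Sum>c\<in>span_of F. inverse (v + c) ^ n)"

text \<open>The highest level is the head of the list.\<close>

fun S :: "('K \<times> nat) list \<Rightarrow> 'k word \<Rightarrow> 'K" where
  "S F [] = 1"
| "S [] (x # u) = 0"
| "S ((v, k) # F) (x # u) = S F (x # u) + emb (snd x) ^ k * level F v (fst x) * S F u"

lemma finite_span: "finite (span_of F)"
  by (induction F rule: span_of.induct) auto

lemma zero_span: "0 \<in> span_of F"
  by (induction F rule: span_of.induct) (auto intro!: image_eqI[where x = "(0, 0)"])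

lemma span_ConsI: "c \<in> span_of F \<Longrightarrow> emb f * v + c \<in> span_of ((v, k) # F)"
  by (auto intro!: image_eqI[where x = "(f, c)"])

lemma span_ConsE:
  assumes "x \<in> span_of ((v, k) # F)"
  obtains f c where "x = emb f * v + c" "c \<in> span_of F"
  using assms by auto

lemma diff_span: "x \<in> span_of F \<Longrightarrow> z \<in> span_of F \<Longrightarrow> x - z \<in> span_of F"
proof (induction F arbitrary: x z rule: span_of.induct)
  case (2 v k F)
  from "2.prems" obtain f c g d where fg: "x = emb f * v + c" "c \<in> span_of F"
     "z = emb g * v + d" "d \<in> span_of F"
    by (metis span_ConsE)
  then have "x - z = emb (f - g) * v + (c - d)" by (simp add: emb_diff algebra_simps)
  then show ?case using 2(1) fg span_ConsI by metis
qed simp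

lemma scale_span: "x \<in> span_of F \<Longrightarrow> emb g * x \<in> span_of F"
proof (induction F arbitrary: x rule: span_of.induct)
  case (2 v k F)
  from "2.prems" obtain f c where fc: "x = emb f * v + c" "c \<in> span_of F" by (metis span_ConsE)
  then have "emb g * x = emb (g * f) * v + emb g * c" by (simp add: emb_mult algebra_simps)
  then show ?case using 2(1) fc span_ConsI by metis
qed simp

sublocale span: finite_subgroup "span_of F" for F
  by unfold_locales (fact finite_span zero_span diff_span infinite_K)+

lemma span_scale_iff: "g \<noteq> 0 \<Longrightarrow> emb g * x \<in> span_of F \<longleftrightarrow> x \<in> span_of F"
  using scale_span[of "emb g * x" F "inverse g"] scale_span[of x F g]
  by (auto simp: emb_inverse simp flip: mult.assoc)

lemma inj_span_Cons:
  assumes "v \<notin> span_of F"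
  shows "inj_on (\<lambda>(f, c). emb f * v + c) (UNIV \<times> span_of F)"
proof (rule inj_onI, clarify)
  fix f c g d assume *: "c \<in> span_of F" "d \<in> span_of F" "emb f * v + c = emb g * v + d"
  then have "emb (f - g) * v = d - c" by (simp add: emb_diff algebra_simps)
  then have "emb (f - g) * v \<in> span_of F" using diff_span[of d F c] * by simp
  then have "f = g" using assms span_scale_iff[of "f - g" v F] by auto
  then show "f = g \<and> c = d" using * by simp
qed

text \<open>The nonzero elements of the span are the nonzero multiples of the monic ones
  \<open>v + c\<close>, and \<open>f\<^sup>-\<^sup>j\<close> sums to \<open>-1\<close> or \<open>0\<close> over the nonzero scalars \<open>f\<close>.\<close>

lemma inv_sum_eq:
  assumes "flag F" "j \<ge> 1"
  shows "span.inv_sum F j = (if (card (UNIV :: 'k set) - 1) dvd j then S F [(j, 1)] else 0)"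
  using assms(1)
proof (induction F rule: span_of.induct)
  case 1
  then show ?case unfolding span.inv_sum_def by simp
next
  case (2 v k F)
  have v: "v \<notin> span_of F" using 2 by simp
  let ?g = "\<lambda>(f, c). emb f * v + c" and ?h = "\<lambda>c::'K. inverse c ^ j"
  have "(\<Sum>c\<in>span_of ((v, k) # F). ?h c) = (\<Sum>f\<in>UNIV. \<Sum>c\<in>span_of F. ?h (emb f * v + c))"
    unfolding span_of.simps sum.reindex[OF inj_span_Cons[OF v]]
    by (simp add: sum.cartesian_product case_prod_unfold)
  also have "\<dots> = (\<Sum>c\<in>span_of F. ?h c)
     + (\<Sum>f\<in>UNIV-{0}. \<Sum>c\<in>span_of F. ?h (emb f * v + c))"
    by (subst sum.remove[of _ 0]) simp_all
  also have "(\<Sum>f\<in>UNIV-{0}. \<Sum>c\<in>span_of F. ?h (emb f * v + c))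
      = (\<Sum>f\<in>UNIV-{0}. emb (inverse f ^ j) * level F v j)"
  proof (rule sum.cong[OF refl])
    fix f :: 'k assume f: "f \<in> UNIV - {0}"
    have "(\<Sum>c\<in>span_of F. ?h (emb f * v + c)) = (\<Sum>c\<in>span_of F. ?h (emb f * (v + c)))"
      by (rule sum.reindex_bij_witness[of _ "\<lambda>c. emb f * c" "\<lambda>c. inverse (emb f) * c"])
         (use f scale_span[of _ F "inverse f"] in
           \<open>auto intro: scale_span simp: distrib_left emb_inverse mult.assoc[symmetric]\<close>)
    then show "(\<Sum>c\<in>span_of F. ?h (emb f * v + c)) = emb (inverse f ^ j) * level F v j"
      by (simp add: level_def sum_distrib_left power_mult_distrib emb_power emb_inverse)
  qed
  also have "\<dots> = emb (if (card (UNIV :: 'k set) - 1) dvd j then -1 else 0) * level F v j"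
    by (simp flip: sum_distrib_right emb_sum add: sum_inverse_power_finite_field)
  finally have *: "(\<Sum>c\<in>span_of ((v, k) # F). ?h c) = (\<Sum>c\<in>span_of F. ?h c)
     + emb (if (card (UNIV :: 'k set) - 1) dvd j then -1 else 0) * level F v j" .
  \<comment> \<open>As \<open>inverse 0 = 0\<close> and \<open>j \<ge> 1\<close>, the summand at 0
    vanishes and may be included.\<close>
  have neg: "span.inv_sum F' j = - (\<Sum>c\<in>span_of F'. ?h c)" for F'
    unfolding span.inv_sum_def using finite_span zero_span \<open>j \<ge> 1\<close>
    by (subst sum.remove[of "span_of F'" 0]) (auto simp: power_0_left)
  from "2.IH" 2(2) show ?case
    by (auto simp: neg * emb_minus simp del: span_of.simps)
qed

text \<open>This is \<open>coset_sum_mult\<close> for the span of \<open>F\<close>: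
  \<open>inv_sum\<close> vanishes unless \<open>q - 1\<close> divides the exponent, which is the
  case distinction in \<open>DeltaC\<close>, and is otherwise the value of a letter.\<close>

lemma level_mult:
  assumes "flag F" "v \<notin> span_of F" "a \<ge> 1" "b \<ge> 1"
  shows "level F v a * level F v b = level F v (a + b)
    + (\<Sum>i=1..<a+b. emb (DeltaC a b (a + b - i)) * S F [(a + b - i, 1)] * level F v i)"
proof -
  have "((-1) ^ (a - 1) * of_nat (a + b - i - 1 choose (a - 1))
          + (-1) ^ (b - 1) * of_nat (a + b - i - 1 choose (b - 1))) * span.inv_sum F (a + b - i)
      = emb (DeltaC a b (a + b - i)) * S F [(a + b - i, 1)]" if "i \<in> {1..<a+b}" for i
    using that assms(1)
    by (subst inv_sum_eq) (auto simp: DeltaC_def emb_add emb_mult emb_power emb_minus emb_of_nat)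
  then show ?thesis
    unfolding level_def span.coset_sum_mult[OF assms(2-4)] by simp
qed

text \<open>Outer induction on the fuel, inner induction on the flag. In the product of values, both
  first letters may sit below the top level (inner hypothesis), exactly one at the top (the two
  \<open>lcons\<close> terms), or both, where \<open>level_mult\<close> produces the diamond
  product.\<close>

lemma S_shf:
  assumes "length a + length b \<le> N" "a \<in> pos_words" "b \<in> pos_words" "flag F"
  shows "lsum (S F) (shf N a b) = S F a * S F b"
  using assms
proof (induction N arbitrary: a b F)
  case 0
  then show ?case by simp
next
  case (Suc N)
  show ?case
  proof (cases "a = [] \<or> b = []")
    case True
    then show ?thesis by (auto split: list.split)
  next
    case False
    then obtain x a' y b' where ab: "a = x # a'" "b = y # b'"
      by (metis neq_Nil_conv)
    let ?j = "\<lambda>i. fst x + fst y - i"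
    let ?z = "\<lambda>i. (i, snd x * snd y)"
    let ?I = "{1..<fst x + fst y}"
    let ?m = "shf N a' b'"
    let ?p = "\<lambda>i. lin (\<lambda>w. shf N [(?j i, 1)] w) ?m"
    have fs: "shf N a' b \<in> fsupp UNIV" "shf N a b' \<in> fsupp UNIV"
      by (rule fsupp_subset[OF fsupp_shf]; use Suc.prems ab in auto)+
    have m: "?m \<in> fsupp {w \<in> pos_words. length w \<le> length a' + length b'}"
      by (rule fsupp_shf) (use Suc.prems ab in auto)
    have jm: "shf N [(?j i, 1)] w \<in> fsupp UNIV"
      if "i \<in> ?I" "w \<in> {w \<in> pos_words. length w \<le> length a' + length b'}" for i and w :: "'k word"
      by (rule fsupp_subset[OF fsupp_shf]) (use that Suc.prems ab in auto)
    have p: "?p i \<in> fsupp UNIV" if "i \<in> ?I" for i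
      by (rule fsupp_lin[OF m]) (rule jm[OF that])
    have p_eval: "lsum (S F) (?p i) = S F [(?j i, 1)] * (S F a' * S F b')"
      if i: "i \<in> ?I" and F: "flag F" for i F
    proof -
      have "lsum (S F) (?p i) = lsum (\<lambda>w. lsum (S F) (shf N [(?j i, 1)] w)) ?m"
        by (rule lsum_lin[OF m jm[OF i]])
      also have "\<dots> = lsum (\<lambda>w. S F [(?j i, 1)] * S F w) ?m"
        by (rule lsum_cong[OF m], rule Suc.IH) (use Suc.prems ab i F in auto)
      also have "\<dots> = S F [(?j i, 1)] * (S F a' * S F b')"
        by (subst lsum_fun_scale, subst Suc.IH) (use Suc.prems ab F in auto)
      finally show ?thesis .
    qed
    have m': "?m \<in> fsupp UNIV" using m by (rule fsupp_subset) simp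
    have lc: "lcons l q \<in> fsupp UNIV" if "q \<in> fsupp UNIV" for l and q :: "'k elem"
      using that by (rule fsupp_lcons) simp
    \<comment> \<open>Stated for every \<open>\<phi>\<close>, because the inner induction compares
      the functionals of \<open>F\<close> and of \<open>(v, k) # F\<close>.\<close>
    have expand: "lsum \<phi> (shf (Suc N) a b)
      = lsum (\<lambda>w. \<phi> (x # w)) (shf N a' b) + lsum (\<lambda>w. \<phi> (y # w)) (shf N a b')
        + (lsum (\<lambda>w. \<phi> (?z (fst x + fst y) # w)) ?m
          + (\<Sum>i\<in>?I. emb (DeltaC (fst x) (fst y) (?j i)) * lsum (\<lambda>w. \<phi> (?z i # w)) (?p i)))" for \<phi>
    proof -
      have eq: "shf (Suc N) a b = (\<lambda>v. (lcons x (shf N a' b) v + lcons y (shf N a b') v)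
        + (lcons (?z (fst x + fst y)) ?m v
          + (\<Sum>i\<in>?I. DeltaC (fst x) (fst y) (?j i) * lcons (?z i) (?p i) v)))"
        by (simp add: ab dia_gen_Cons)
      have sum: "(\<lambda>v. \<Sum>i\<in>?I. DeltaC (fst x) (fst y) (?j i) * lcons (?z i) (?p i) v) \<in> fsupp UNIV"
        by (intro fsupp_sum fsupp_scale lc p)
      have "lsum \<phi> (\<lambda>v. \<Sum>i\<in>?I. DeltaC (fst x) (fst y) (?j i) * lcons (?z i) (?p i) v)
        = (\<Sum>i\<in>?I. lsum \<phi> (\<lambda>v. DeltaC (fst x) (fst y) (?j i) * lcons (?z i) (?p i) v))"
        by (rule lsum_sum[where A = UNIV]) (intro fsupp_scale lc p)
      moreover have "lsum \<phi> (\<lambda>v. DeltaC (fst x) (fst y) (?j i) * lcons (?z i) (?p i) v)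
        = emb (DeltaC (fst x) (fst y) (?j i)) * lsum (\<lambda>w. \<phi> (?z i # w)) (?p i)"
        if "i \<in> ?I" for i
        unfolding lsum_scale lsum_lcons[OF p[OF that]] ..
      ultimately have sum_eq: "lsum \<phi> (\<lambda>v. \<Sum>i\<in>?I. DeltaC (fst x) (fst y) (?j i) * lcons (?z i) (?p i) v)
        = (\<Sum>i\<in>?I. emb (DeltaC (fst x) (fst y) (?j i)) * lsum (\<lambda>w. \<phi> (?z i # w)) (?p i))"
        by (simp only: cong: sum.cong)
      show ?thesis
        unfolding eq lsum_add[OF fsupp_add[OF lc[OF fs(1)] lc[OF fs(2)]] fsupp_add[OF lc[OF m'] sum]]
          lsum_add[OF lc[OF fs(1)] lc[OF fs(2)]] lsum_add[OF lc[OF m'] sum]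
          sum_eq lsum_lcons[OF fs(1)] lsum_lcons[OF fs(2)] lsum_lcons[OF m'] ..
    qed
    have pos: "fst x \<ge> 1" "fst y \<ge> 1" using Suc.prems ab by auto
    show ?thesis using Suc.prems(4)
    proof (induction F rule: span_of.induct)
      case 1
      then show ?case unfolding expand by (simp add: ab lsum_def)
    next
      case (2 v k F)
      have F: "flag F" and v: "v \<notin> span_of F" using "2.prems" by auto
      have top: "lsum (\<lambda>w. S ((v, k) # F) (l # w)) q = lsum (\<lambda>w. S F (l # w)) q
          + emb (snd l) ^ k * level F v (fst l) * lsum (S F) q" for l and q :: "'k elem"
        by (simp add: lsum_fun_add lsum_fun_scale)
      have IH: "lsum (S F) (shf (Suc N) a b) = S F a * S F b" using "2.IH" F by simp
      have 1: "lsum (S F) (shf N a' b) = S F a' * S F b" "lsum (S F) (shf N a b') = S F a * S F b'"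
        "lsum (S F) ?m = S F a' * S F b'"
        by (rule Suc.IH; use Suc.prems ab F in simp)+
      let ?ch = "emb (snd x) ^ k * emb (snd y) ^ k"
      let ?D = "\<lambda>i. emb (DeltaC (fst x) (fst y) (?j i))"
      have ch: "emb (snd x * snd y) ^ k = ?ch" by (simp add: emb_mult power_mult_distrib)
      have sum: "(\<Sum>i\<in>?I. ?D i * (lsum (\<lambda>w. S F (?z i # w)) (?p i)
            + ?ch * level F v i * lsum (S F) (?p i)))
          = (\<Sum>i\<in>?I. ?D i * lsum (\<lambda>w. S F (?z i # w)) (?p i))
            + ?ch * (\<Sum>i\<in>?I. ?D i * S F [(?j i, 1)] * level F v i) * (S F a' * S F b')"
        (is "?l = ?r")
      proof -
        have "?l = (\<Sum>i\<in>?I. ?D i * lsum (\<lambda>w. S F (?z i # w)) (?p i)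
            + ?ch * (?D i * S F [(?j i, 1)] * level F v i) * (S F a' * S F b'))"
          by (intro sum.cong refl) (simp only: p_eval[OF _ F] distrib_left mult_ac)
        then show ?thesis by (simp only: sum.distrib sum_distrib_left sum_distrib_right)
      qed
      have "lsum (S ((v, k) # F)) (shf (Suc N) a b) = lsum (S F) (shf (Suc N) a b)
         + emb (snd x) ^ k * level F v (fst x) * (S F a' * S F b)
         + emb (snd y) ^ k * level F v (fst y) * (S F a * S F b')
         + ?ch * (level F v (fst x + fst y) + (\<Sum>i\<in>?I. ?D i * S F [(?j i, 1)] * level F v i))
             * (S F a' * S F b')"
        unfolding expand top 1 fst_conv snd_conv ch sum
        by (simp only: distrib_left distrib_right add_ac)
      also have "\<dots> = S ((v, k) # F) a * S ((v, k) # F) b"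
        unfolding IH level_mult[OF F v pos, symmetric] by (simp add: ab algebra_simps)
      finally show ?case .
    qed
  qed
qed

lemma S_sh: "a \<in> pos_words \<Longrightarrow> b \<in> pos_words \<Longrightarrow> flag F \<Longrightarrow> lsum (S F) (sh a b) = S F a * S F b"
  unfolding sh_def by (rule S_shf) auto

lemma S_shE:
  assumes "p \<in> fsupp pos_words" "r \<in> fsupp pos_words" "flag F"
  shows "lsum (S F) (shE p r) = lsum (S F) p * lsum (S F) r"
proof -
  have "lsum (S F) (shE p r) = lsum (\<lambda>w. lsum (\<lambda>u. lsum (S F) (sh w u)) r) p"
    unfolding shE_def by (rule lsum_bilin[OF assms(1,2) fsupp_sh])
  also have "\<dots> = lsum (\<lambda>w. lsum (\<lambda>u. S F w * S F u) r) p"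
    using assms by (intro lsum_cong[OF assms(1)] lsum_cong[OF assms(2)] S_sh) auto
  finally show ?thesis by (simp add: lsum_fun_scale lsum_fun_scale_right)
qed

end

section \<open>Independence of the power sums\<close>

context field_embedding
begin

text \<open>A Vandermonde argument: combine the hypotheses with the coefficients of a polynomial
  vanishing at all embedded scalars except that of \<open>\<eta>\<close>.\<close>

lemma character_independence:
  assumes "\<And>k::nat. (\<Sum>\<epsilon>\<in>UNIV. emb \<epsilon> ^ k * h \<epsilon>) = 0"
  shows "h \<eta> = 0"
proof -
  define Q where "Q = (\<Prod>\<epsilon>\<in>UNIV-{\<eta>}. [:- emb \<epsilon>, 1:])"
  have "(\<Sum>\<epsilon>\<in>UNIV. poly Q (emb \<epsilon>) * h \<epsilon>)
      = (\<Sum>k\<le>degree Q. coeff Q k * (\<Sum>\<epsilon>\<in>UNIV. emb \<epsilon> ^ k * h \<epsilon>))"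
    unfolding poly_altdef sum_distrib_left sum_distrib_right
    by (subst sum.swap) (simp only: mult.assoc)
  then have "0 = (\<Sum>\<epsilon>\<in>UNIV. poly Q (emb \<epsilon>) * h \<epsilon>)" by (simp only: assms) simp
  also have "\<dots> = poly Q (emb \<eta>) * h \<eta>"
  proof -
    have "poly Q (emb \<epsilon>) = 0" if "\<epsilon> \<noteq> \<eta>" for \<epsilon>
      using that by (auto simp: Q_def poly_prod emb_eq_iff)
    then show ?thesis by (subst sum.remove[of _ \<eta>]) (auto intro!: sum.neutral)
  qed
  finally show ?thesis by (auto simp: Q_def poly_prod emb_eq_iff)
qed

text \<open>Clearing denominators and evaluating at \<open>0\<close> isolates the pole of highest order.\<close>

lemma level_independence:
  assumes J: "finite J" "0 \<notin> J" and W: "infinite W"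
    and 0: "\<And>v. v \<in> W \<Longrightarrow> v \<notin> span_of F \<Longrightarrow> (\<Sum>n\<in>J. g n * level F v n) = 0"
    and m: "m \<in> J"
  shows "g m = 0"
proof (rule ccontr)
  assume "g m \<noteq> 0"
  let ?U = "span_of F"
  define J' where "J' = {n \<in> J. g n \<noteq> 0}"
  define N where "N = Max J'"
  have J': "finite J'" "J' \<noteq> {}" using J m \<open>g m \<noteq> 0\<close> by (auto simp: J'_def)
  then have N: "N \<in> J'" and le: "\<And>n. n \<in> J' \<Longrightarrow> n \<le> N" by (auto simp: N_def)
  then have "N > 0" "g N \<noteq> 0" using J(2) by (auto simp: J'_def intro: Nat.gr0I)
  \<comment> \<open>The combination of levels times \<open>\<Prod>d\<in>?U. (d + v) ^ N\<close>; a
    polynomial, as \<open>N\<close> is the largest order with nonzero coefficient.\<close>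
  define Q where "Q = (\<Sum>n\<in>J'. \<Sum>c\<in>?U. [:g n:] * ([:c, 1:] ^ (N - n) * (\<Prod>d\<in>?U-{c}. [:d, 1:] ^ N)))"
  have Q: "poly Q v = (\<Sum>n\<in>J'. \<Sum>c\<in>?U. g n * ((c + v) ^ (N - n) * (\<Prod>d\<in>?U-{c}. (d + v) ^ N)))" for v
    by (simp add: Q_def poly_sum poly_prod)
  have "poly Q v = 0" if v: "v \<in> W - ?U" for v
  proof -
    have nz: "c + v \<noteq> 0" if "c \<in> ?U" for c
      using v span.minus_U[OF that] by (auto simp: add_eq_0_iff)
    have "poly Q v = (\<Sum>n\<in>J'. \<Sum>c\<in>?U. g n * (inverse (v + c) ^ n * (\<Prod>d\<in>?U. (d + v) ^ N)))"
      unfolding Q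
    proof (intro sum.cong refl)
      fix n c assume n: "n \<in> J'" and c: "c \<in> ?U"
      have "(c + v) ^ N = (c + v) ^ n * (c + v) ^ (N - n)" using le[OF n] by (simp flip: power_add)
      then have "inverse (c + v) ^ n * (c + v) ^ N = (c + v) ^ (N - n)"
        using nz[OF c] by (simp flip: mult.assoc power_mult_distrib)
      moreover have "(\<Prod>d\<in>?U. (d + v) ^ N) = (c + v) ^ N * (\<Prod>d\<in>?U-{c}. (d + v) ^ N)"
        using c finite_span by (simp add: prod.remove)
      ultimately show "g n * ((c + v) ^ (N - n) * (\<Prod>d\<in>?U-{c}. (d + v) ^ N))
          = g n * (inverse (v + c) ^ n * (\<Prod>d\<in>?U. (d + v) ^ N))"
        by (simp add: add.commute flip: mult.assoc)
    qed
    also have "\<dots> = (\<Sum>n\<in>J'. g n * level F v n) * (\<Prod>d\<in>?U. (d + v) ^ N)"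
      by (simp add: level_def sum_distrib_left sum_distrib_right mult.assoc)
    also have "(\<Sum>n\<in>J'. g n * level F v n) = (\<Sum>n\<in>J. g n * level F v n)"
      using J by (intro sum.mono_neutral_left) (auto simp: J'_def)
    finally show ?thesis using 0 v by simp
  qed
  then have "W - ?U \<subseteq> {v. poly Q v = 0}" by blast
  moreover have "infinite (W - ?U)" using W finite_span by (simp add: Diff_infinite_finite)
  ultimately have "Q = 0" using poly_roots_finite finite_subset by metis
  then have "0 = poly Q 0" by simp
  \<comment> \<open>At 0 the factor for \<open>d = 0\<close> removes all summands except those with
    \<open>c = 0\<close>; among these, \<open>0 ^ (N - n)\<close> will leave only
    \<open>n = N\<close>.\<close>
  also have "\<dots> = (\<Sum>n\<in>J'. g n * (0 ^ (N - n) * (\<Prod>d\<in>?U-{0}. d ^ N)))"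
    unfolding Q
  proof (rule sum.cong[OF refl])
    fix n
    have "(\<Prod>d\<in>?U-{c}. (d + 0) ^ N) = 0" if "c \<noteq> 0" for c
      by (rule prod_zero) (use that zero_span finite_span \<open>N > 0\<close> in \<open>auto intro!: bexI[of _ 0]\<close>)
    then have "(\<Sum>c\<in>?U-{0}. g n * ((c + 0) ^ (N - n) * (\<Prod>d\<in>?U-{c}. (d + 0) ^ N))) = 0"
      by (intro sum.neutral) (simp del: prod_zero_iff add_0_right)
    then show "(\<Sum>c\<in>?U. g n * ((c + 0) ^ (N - n) * (\<Prod>d\<in>?U-{c}. (d + 0) ^ N)))
        = g n * (0 ^ (N - n) * (\<Prod>d\<in>?U-{0}. d ^ N))"
      using zero_span finite_span by (subst sum.remove[of _ 0]) simp_all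
  qed
  also have "\<dots> = g N * (\<Prod>d\<in>?U-{0}. d ^ N)"
  proof -
    have "g n * (0 ^ (N - n) * (\<Prod>d\<in>?U-{0}. d ^ N)) = 0" if "n \<in> J' - {N}" for n
      using that le[of n] by (simp add: power_0_left)
    then have "(\<Sum>n\<in>J'-{N}. g n * (0 ^ (N - n) * (\<Prod>d\<in>?U-{0}. d ^ N))) = 0"
      by (intro sum.neutral ballI)
    then show ?thesis using N J'(1) by (simp add: sum.remove[of _ N])
  qed
  finally show False using \<open>g N \<noteq> 0\<close> finite_span by auto
qed

text \<open>The coefficients lie in \<open>K\<close>: evaluating one factor of a tensor leaves such
  a combination of words in the other factor.\<close>

definition ksum :: "('K \<times> nat) list \<Rightarrow> ('k word \<Rightarrow> 'K) \<Rightarrow> 'K" where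
  "ksum F p = (\<Sum>w\<in>supp p. p w * S F w)"

text \<open>Induction on the maximal depth. Putting a level \<open>(v, k)\<close> on top of a flag
  adds the contributions of the words whose first letter sits there. Varying \<open>k\<close>
  separates their characters, varying \<open>v\<close> in \<open>W\<close> their weights, and the
  tails have smaller depth. The empty flag then detects the empty word. \<open>W\<close> will be the
  image of \<open>E\<close>, whose elements can be lifted, or all of \<open>K\<close>.\<close>

lemma S_independence:
  assumes W: "infinite W"
    and p: "p \<in> fsupp pos_words"
    and 0: "\<And>F. flag F \<Longrightarrow> fst ` set F \<subseteq> W \<Longrightarrow> ksum F p = 0"
  shows "p w = 0"
proof -
  have "\<exists>N. \<forall>w\<in>supp p. length w \<le> N"
    using fsuppD(1)[OF p] by (metis finite_imageI finite_nat_set_iff_bounded_le imageI)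
  then obtain N where N: "\<forall>w\<in>supp p. length w \<le> N" ..
  then show ?thesis using p 0
  proof (induction N arbitrary: p w)
    case (0 p)
    then have "supp p \<subseteq> {[]}" by auto
    moreover have "p [] = 0"
    proof (rule ccontr)
      assume "p [] \<noteq> 0"
      then have "supp p = {[]}" using \<open>supp p \<subseteq> {[]}\<close> by (auto simp: supp_def)
      then show False using 0(3)[of "[]"] \<open>p [] \<noteq> 0\<close> by (simp add: ksum_def)
    qed
    ultimately show ?case by (auto simp: supp_def)
  next
    case (Suc N p)
    have finp: "finite (supp p)" using Suc.prems(2) by (rule fsuppD)
    define J where "J = (\<lambda>w. fst (hd w)) ` (supp p - {[]})"
    define q where "q x = (\<lambda>u. p (x # u))" for x
    have suppq: "u \<in> supp (q x) \<longleftrightarrow> x # u \<in> supp p" for x u by (simp add: q_def supp_def)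
    have J: "finite J" "0 \<notin> J"
      using finp fsuppD(2)[OF Suc.prems(2)]
      by (auto simp: J_def) (metis hd_Cons_tl not_one_le_zero pos_words_Cons)
    have finq: "finite (supp (q x))" for x
      by (rule finite_surj[OF finp, of _ tl]) (auto simp: suppq intro!: image_eqI[where x = "x # _"])
    have q_0: "ksum F (q (n, \<epsilon>)) = 0" if F: "flag F" "fst ` set F \<subseteq> W" for F n \<epsilon>
    proof (cases "n \<in> J")
      case False
      then have "supp (q (n, \<epsilon>)) = {}"
        by (force simp: J_def suppq image_iff)
      then show ?thesis by (simp add: ksum_def)
    next
      case True
      have twist: "(\<Sum>\<epsilon>\<in>UNIV. emb \<epsilon> ^ k * (\<Sum>n\<in>J. ksum F (q (n, \<epsilon>)) * level F v n)) = 0"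
        if v: "v \<in> W" "v \<notin> span_of F" for v k
      proof -
        define t where "t w = p w * emb (snd (hd w)) ^ k * level F v (fst (hd w)) * S F (tl w)" for w
        have "ksum ((v, k) # F) p = 0" "ksum F p = 0"
          using Suc.prems(3) F v by auto
        moreover have "ksum ((v, k) # F) p = ksum F p + (\<Sum>w\<in>supp p-{[]}. t w)"
        proof -
          have "ksum ((v, k) # F) p = (\<Sum>w\<in>supp p. p w * S F w + (if w = [] then 0 else t w))"
            unfolding ksum_def
          proof (rule sum.cong[OF refl])
            fix w
            show "p w * S ((v, k) # F) w = p w * S F w + (if w = [] then 0 else t w)"
              by (cases w) (simp_all add: t_def algebra_simps)
          qed
          also have "\<dots> = ksum F p + (\<Sum>w\<in>supp p. if w = [] then 0 else t w)"
            by (simp add: sum.distrib ksum_def)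
          also have "(\<Sum>w\<in>supp p. if w = [] then 0 else t w) = (\<Sum>w\<in>supp p-{[]}. t w)"
            using finp by (intro sum.mono_neutral_cong_right) auto
          finally show ?thesis .
        qed
        ultimately have "0 = (\<Sum>w\<in>supp p-{[]}. t w)" by simp
        also have "\<dots> = (\<Sum>(x, u)\<in>(SIGMA x:J \<times> UNIV. supp (q x)). t (x # u))"
          by (rule sum.reindex_bij_witness[of _ "\<lambda>(x, u). x # u" "\<lambda>w. (hd w, tl w)"])
             (auto simp: suppq J_def mem_Times_iff)
        also have "\<dots> = (\<Sum>x\<in>J \<times> UNIV. \<Sum>u\<in>supp (q x). t (x # u))"
          using J finq by (subst sum.Sigma) auto
        also have "\<dots> = (\<Sum>x\<in>J \<times> UNIV. emb (snd x) ^ k * (ksum F (q x) * level F v (fst x)))"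
          by (simp add: ksum_def t_def q_def sum_distrib_left sum_distrib_right mult_ac)
        also have "\<dots> = (\<Sum>n\<in>J. \<Sum>\<epsilon>\<in>UNIV. emb \<epsilon> ^ k * (ksum F (q (n, \<epsilon>)) * level F v n))"
          by (simp add: sum.cartesian_product case_prod_unfold)
        also have "\<dots> = (\<Sum>\<epsilon>\<in>UNIV. emb \<epsilon> ^ k * (\<Sum>n\<in>J. ksum F (q (n, \<epsilon>)) * level F v n))"
          unfolding sum_distrib_left by (rule sum.swap)
        finally show ?thesis by simp
      qed
      have "(\<Sum>n\<in>J. ksum F (q (n, \<epsilon>)) * level F v n) = 0" if "v \<in> W" "v \<notin> span_of F" for v
        by (rule character_independence[where h = "\<lambda>\<epsilon>. \<Sum>n\<in>J. ksum F (q (n, \<epsilon>)) * level F v n"])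
           (rule twist[OF that])
      then show ?thesis by (rule level_independence[OF J W _ True])
    qed
    have q: "q x u = 0" for x u
    proof (rule Suc.IH)
      show "\<forall>u\<in>supp (q x). length u \<le> N" using Suc.prems(1) by (force simp: suppq)
      show "q x \<in> fsupp pos_words"
      proof (rule fsuppI[OF finq])
        show "supp (q x) \<subseteq> pos_words"
        proof
          fix u assume "u \<in> supp (q x)"
          then have "x # u \<in> pos_words" using fsuppD(2)[OF Suc.prems(2), of "x # u"] suppq by blast
          then show "u \<in> pos_words" by simp
        qed
      qed (simp add: supp_def)
    qed (use q_0 in \<open>cases x; auto\<close>)
    have supp: "supp p \<subseteq> {[]}"
    proof
      fix w assume "w \<in> supp p"
      then show "w \<in> {[]}" using q by (cases w) (auto simp: supp_def q_def)
    qed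
    have "p [] = 0"
    proof (rule ccontr)
      assume "p [] \<noteq> 0"
      then have "supp p = {[]}" using supp by (auto simp: supp_def)
      then show False using Suc.prems(3)[of "[]"] \<open>p [] \<noteq> 0\<close> by (simp add: ksum_def)
    qed
    then show ?case using supp by (auto simp: supp_def)
  qed
qed

section \<open>The coproduct as splitting of flags\<close>

text \<open>For \<open>1 \<le> j \<le> wt a\<close> the second binomial in
  \<open>DeltaC 1 (wt a + 1) j\<close> is 0, so this factor only tests whether \<open>q - 1\<close>
  divides \<open>j\<close>. Together with the value of the letter it gives
  \<open>inv_sum\<close>.\<close>

lemma S_bracket:
  assumes a: "a \<in> unit_words n" and F: "flag F"
  shows "lsum (S F) (bracket a) = (-1) ^ length a * prod_list (map (\<lambda>x. span.inv_sum F (fst x)) a)"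
proof -
  have "lsum (S F) (foldr (\<lambda>x. shE (mono [x])) b (mono [])) = prod_list (map (\<lambda>x. S F [x]) b)
      \<and> foldr (\<lambda>x. shE (mono [x])) b (mono []) \<in> fsupp pos_words"
    if "b \<in> pos_words" for b
    using that by (induction b) (auto simp: S_shE F fsupp_mono fsupp_shE)
  note fold = this[OF unit_words_pos[OF a]]
  define d :: "'k letter \<Rightarrow> 'k" where "d x = DeltaC 1 (wt a + 1) (fst x)" for x
  have factor: "emb (d x) * S F [x] = span.inv_sum F (fst x)" if "x \<in> set a" for x
  proof -
    have x: "fst x \<ge> 1" "snd x = 1" "fst x \<le> wt a"
      using a that wt_ge[OF that] by (auto simp: unit_words_def)
    then have "x = (fst x, 1)" by (simp add: prod_eq_iff)
    then show ?thesis
      using x inv_sum_eq[OF F x(1)] by (auto simp: d_def DeltaC_def binomial_eq_0)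
  qed
  have prod: "emb (prod_list (map d b)) * prod_list (map (\<lambda>x. S F [x]) b)
      = prod_list (map (\<lambda>x. span.inv_sum F (fst x)) b)" if "set b \<subseteq> set a" for b
    using that
  proof (induction b)
    case (Cons x b)
    have "emb (prod_list (map d (x # b))) * prod_list (map (\<lambda>x. S F [x]) (x # b))
        = (emb (d x) * S F [x]) * (emb (prod_list (map d b)) * prod_list (map (\<lambda>x. S F [x]) b))"
      by (simp only: list.map prod_list.Cons emb_mult mult_ac)
    also have "\<dots> = span.inv_sum F (fst x) * prod_list (map (\<lambda>x. span.inv_sum F (fst x)) b)"
      using Cons factor[of x] by simp
    finally show ?case by simp
  qed simp
  show ?thesis
    unfolding bracket_def lsum_scale using fold prod[of a, unfolded d_def[abs_def]]
    by (simp add: emb_mult emb_power emb_minus mult.assoc)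
qed

text \<open>The binomial expansion of \<open>G\<^bsup>-s\<^esup>\<close>; division by \<open>s!\<close> is not possible in characteristic
  \<open>p\<close>, so it is verified by recursion on \<open>s\<close>.\<close>

definition inv_G_power :: "('K \<times> nat) list \<Rightarrow> nat \<Rightarrow> 'K fps" where
  "inv_G_power F s = Abs_fps (\<lambda>n. \<Sum>a\<in>(unit_words n :: 'k word set).
     of_nat (s + length a - 1 choose length a) * (-1) ^ length a
       * prod_list (map (\<lambda>x. span.inv_sum F (fst x)) a))"

lemma sum_unit_words_Cons:
  "(\<Sum>i=1..n. \<Sum>a\<in>unit_words (n - i). \<phi> ((i, 1) # a)) = (\<Sum>a\<in>unit_words n - {[]}. \<phi> (a :: 'k word))"
proof -
  have "(\<Sum>i=1..n. \<Sum>a\<in>unit_words (n - i). \<phi> ((i, 1) # a))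
     = (\<Sum>(i, a)\<in>(SIGMA i:{1..n}. unit_words (n - i)). \<phi> ((i, 1) # a))"
    by (subst sum.Sigma) (auto intro: finite_unit_words)
  also have "\<dots> = (\<Sum>a\<in>unit_words n - {[]}. \<phi> a)"
  proof (rule sum.reindex_bij_witness[of _ "\<lambda>a. (fst (hd a), tl a)" "\<lambda>(i, a). (i, 1) # a"])
    fix a assume "a \<in> unit_words n - {[] :: 'k word}"
    then obtain x b where "a = x # b" "x # b \<in> unit_words n" by (cases a) auto
    then show "(case (fst (hd a), tl a) of (i, a) \<Rightarrow> (i, 1) # a) = a"
      "(fst (hd a), tl a) \<in> (SIGMA i:{1..n}. unit_words (n - i))"
      by (auto simp: unit_words_def prod_eq_iff)
  qed (auto simp: unit_words_def)
  finally show ?thesis .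
qed

text \<open>The coefficient of \<open>G\<close> in degree \<open>i \<ge> 1\<close> acts as a new
  first letter \<open>(i, 1)\<close>, with a change of sign. Collecting equal words is Pascal's
  rule.\<close>

lemma inv_G_power_Suc: "inv_G_power F (Suc s) * span.G F = inv_G_power F s"
proof (rule fps_ext)
  fix n
  define m where "m a = (-1) ^ length a * prod_list (map (\<lambda>x. span.inv_sum F (fst x)) a)" for a :: "'k word"
  have nth: "inv_G_power F t $ n = (\<Sum>a\<in>unit_words n. of_nat (t + length a - 1 choose length a) * m a)" for t n
    by (simp add: inv_G_power_def m_def mult.assoc)
  have "(inv_G_power F (Suc s) * span.G F) $ n
      = (\<Sum>i=0..n. span.G F $ i * inv_G_power F (Suc s) $ (n - i))"
    by (subst mult.commute) (rule fps_mult_nth)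
  also have "\<dots> = inv_G_power F (Suc s) $ n
      + (\<Sum>i=1..n. span.inv_sum F i * inv_G_power F (Suc s) $ (n - i))"
    by (subst sum.atLeast_Suc_atMost) (simp_all add: span.G_def)
  also have "(\<Sum>i=1..n. span.inv_sum F i * inv_G_power F (Suc s) $ (n - i))
      = (\<Sum>i=1..n. \<Sum>a\<in>unit_words (n - i).
          - of_nat (s + length ((i, 1) # a) - 1 choose (length ((i, 1) # a) - 1)) * m ((i, 1) # a))"
    by (intro sum.cong refl) (simp add: nth m_def sum_distrib_left mult_ac)
  also have "\<dots> = (\<Sum>a\<in>unit_words n - {[]}. - of_nat (s + length a - 1 choose (length a - 1)) * m a)"
    by (rule sum_unit_words_Cons)
  also have "inv_G_power F (Suc s) $ n + \<dots>
      = (\<Sum>a\<in>unit_words n. of_nat (s + length a choose length a) * m a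
          + (if a = [] then 0 else - of_nat (s + length a - 1 choose (length a - 1)) * m a))"
  proof -
    have "(\<Sum>a\<in>unit_words n - {[]}. - of_nat (s + length a - 1 choose (length a - 1)) * m a)
      = (\<Sum>a\<in>unit_words n. if a = [] then 0 else - of_nat (s + length a - 1 choose (length a - 1)) * m a)"
      using finite_unit_words by (intro sum.mono_neutral_cong_left) auto
    then show ?thesis by (simp add: nth sum.distrib)
  qed
  also have "\<dots> = inv_G_power F s $ n"
    unfolding nth
  proof (rule sum.cong[OF refl])
    fix a :: "'k word"
    show "of_nat (s + length a choose length a) * m a
          + (if a = [] then 0 else - of_nat (s + length a - 1 choose (length a - 1)) * m a)
        = of_nat (s + length a - 1 choose length a) * m a"
      by (cases a) (simp_all add: algebra_simps)
  qed
  finally show "(inv_G_power F (Suc s) * span.G F) $ n = inv_G_power F s $ n" .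
qed

lemma inv_G_power_mult: "inv_G_power F s * span.G F ^ s = 1"
proof (induction s)
  case 0
  have "inv_G_power F 0 = 1"
  proof (rule fps_ext)
    fix n
    \<comment> \<open>For the empty word natural subtraction gives \<open>0 choose 0 = 1\<close>, as
      required at \<open>s = 0\<close>.\<close>
    have "(length a - 1 choose length a) = (if a = [] then 1 else 0)" for a :: "'k word"
      by (cases a) auto
    then have "inv_G_power F 0 $ n = (\<Sum>a\<in>(unit_words n :: 'k word set). if a = [] then 1 else 0)"
      unfolding inv_G_power_def by (auto intro!: sum.cong)
    also have "\<dots> = (1 :: 'K fps) $ n"
      by (simp add: finite_unit_words) (auto simp: unit_words_def)
    finally show "inv_G_power F 0 $ n = 1 $ n" .
  qed
  then show ?case by simp
next
  case (Suc s)
  then show ?case by (simp add: inv_G_power_Suc flip: mult.assoc)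
qed

text \<open>The value on \<open>F\<close> of everything that the coproduct of a letter of weight
  \<open>n\<close> pairs with the letter of weight \<open>r\<close>.\<close>

definition kappa :: "('K \<times> nat) list \<Rightarrow> nat \<Rightarrow> nat \<Rightarrow> 'K" where
  "kappa F n r = (\<Sum>a\<in>unit_words (n - r).
     of_nat (r + length a - 2 choose length a) * lsum (S F) (bracket a))"

lemma kappa_eq:
  assumes "flag F" "r \<ge> 1"
  shows "kappa F n r = inv_G_power F (r - 1) $ (n - r)"
  unfolding kappa_def inv_G_power_def fps_nth_Abs_fps
proof (rule sum.cong[OF refl])
  fix a :: "'k word" assume a: "a \<in> unit_words (n - r)"
  have "r + length a - 2 = r - 1 + length a - 1" using assms(2) by simp
  then show "of_nat (r + length a - 2 choose length a) * lsum (S F) (bracket a)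
      = of_nat (r - 1 + length a - 1 choose length a) * (-1) ^ length a
          * prod_list (map (\<lambda>x. span.inv_sum F (fst x)) a)"
    by (simp add: S_bracket[OF a assms(1)] mult.assoc)
qed

text \<open>The quotient of a flag by its lower part \<open>F\<close>, transported into the field by the additive
  map with kernel the span of \<open>F\<close>.\<close>

definition upper :: "('K \<times> nat) list \<Rightarrow> ('K \<times> nat) list \<Rightarrow> ('K \<times> nat) list" where
  "upper F F' = map (\<lambda>(v, k). (span.E F v, k)) F'"

lemma E_emb_mult: "span.E F (emb f * x) = emb f * span.E F x"
proof (cases "f = 0")
  case False
  then show ?thesis
    using scale_span[of _ F "inverse f"]
    by (intro span.E_scale scale_span) (auto simp: emb_inverse)
qed (simp add: span.E_0)

lemma span_upper: "span_of (upper F F') = span.E F ` span_of (F' @ F)"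
proof (induction F' rule: span_of.induct)
  case 1
  have "span.E F ` span_of F = {0}"
    using zero_span[of F] by (auto simp: span.E_eq_0_iff span.E_0 image_iff intro!: bexI[of _ 0])
  then show ?case by (simp add: upper_def)
next
  case (2 v k F')
  have "span_of (upper F ((v, k) # F'))
      = (\<lambda>(f, c). emb f * span.E F v + c) ` (UNIV \<times> span_of (upper F F'))"
    by (simp add: upper_def)
  also have "\<dots> = (\<lambda>(f, c). span.E F (emb f * v + c)) ` (UNIV \<times> span_of (F' @ F))"
    unfolding 2 by (force simp: span.E_add E_emb_mult)
  also have "\<dots> = span.E F ` span_of (((v, k) # F') @ F)"
    by (simp add: image_image case_prod_unfold)
  finally show ?case .
qed

lemma span_append: "span_of F \<subseteq> span_of (F' @ F)"
proof (induction F' rule: span_of.induct)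
  case (2 v k F')
  have "c \<in> span_of ((v, k) # F' @ F)" if "c \<in> span_of (F' @ F)" for c
    using span_ConsI[OF that, of 0 v k] by simp
  then show ?case using 2 by auto
qed simp

lemma flag_append: "flag (F' @ F) \<Longrightarrow> flag F"
  by (induction F' rule: span_of.induct) auto

text \<open>The fibres of \<open>E\<close> on the span of \<open>F' @ F\<close> are cosets of the
  span of \<open>F\<close>; apply \<open>coset_power_sum\<close> to each of them.\<close>

lemma level_append:
  assumes "flag (F' @ F)" "v \<notin> span_of (F' @ F)" "n \<ge> 1"
  shows "level (F' @ F) v n
    = (\<Sum>r=1..n. kappa F n r * level (upper F F') (span.E F v) r)"
proof -
  let ?V = "span_of (F' @ F)" and ?E = "span.E F"
  have F: "flag F" using assms(1) by (rule flag_append)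
  have "level (F' @ F) v n = (\<Sum>c'\<in>?E ` ?V. \<Sum>c\<in>{c \<in> ?V. ?E c = c'}. inverse (v + c) ^ n)"
    unfolding level_def by (rule sum.image_gen[OF finite_span])
  also have "\<dots> = (\<Sum>c'\<in>?E ` ?V. \<Sum>r=1..n. inverse (?E v + c') ^ r * kappa F n r)"
  proof (rule sum.cong[OF refl])
    fix c' assume "c' \<in> ?E ` ?V"
    then obtain d where d: "d \<in> ?V" "c' = ?E d" by blast
    have "v + d \<notin> span_of F"
    proof
      assume "v + d \<in> span_of F"
      then have "v + d - d \<in> ?V" using span_append d(1) diff_span by blast
      then show False using assms(2) by simp
    qed
    have "(\<Sum>c\<in>{c \<in> ?V. ?E c = c'}. inverse (v + c) ^ n) = (\<Sum>c\<in>span_of F. inverse (v + d + c) ^ n)"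
    proof (rule sum.reindex_bij_witness[of _ "\<lambda>c. d + c" "\<lambda>c. c - d"])
      fix c assume c: "c \<in> span_of F"
      then have "d + c \<in> ?V" using d(1) span_append span.add_U by blast
      then show "d + c \<in> {c \<in> ?V. ?E c = c'}"
        using d c by (simp add: span.E_add span.E_eq_0_iff)
    qed (use d in \<open>auto simp: span.E_eq_iff\<close>)
    also have "\<dots> = (\<Sum>r=1..n. inverse (?E (v + d)) ^ r * inv_G_power F (r - 1) $ (n - r))"
      by (rule span.coset_power_sum[OF \<open>v + d \<notin> span_of F\<close> assms(3) inv_G_power_mult])
    also have "\<dots> = (\<Sum>r=1..n. inverse (?E v + c') ^ r * kappa F n r)"
      by (intro sum.cong refl) (simp add: kappa_eq[OF F] d span.E_add)
    finally show "(\<Sum>c\<in>{c \<in> ?V. ?E c = c'}. inverse (v + c) ^ n)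
        = (\<Sum>r=1..n. inverse (?E v + c') ^ r * kappa F n r)" .
  qed
  also have "\<dots> = (\<Sum>r=1..n. \<Sum>c'\<in>?E ` ?V. inverse (?E v + c') ^ r * kappa F n r)"
    by (rule sum.swap)
  finally show ?thesis
    by (simp add: level_def span_upper sum_distrib_left mult.commute)
qed

lemma lsum_tmono [simp]: "lsum \<phi> (tmono a b) = \<phi> (a, b)"
  unfolding tmono_def by (subst lsum_tensor[where A = UNIV and B = UNIV]) (auto intro: fsupp_mono)

lemma lsum_cop_red:
  "lsum (\<lambda>s. \<psi> (fst s) * S F (snd s)) (cop_red x)
     = (\<Sum>r=1..fst x. kappa F (fst x) r * \<psi> [(r, snd x)])"
proof -
  have fs: "tensor (mono [(r, snd x)]) (bracket a) \<in> fsupp UNIV"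
    if "a \<in> unit_words n" for a n and r :: nat
    using fsupp_tensor[OF fsupp_mono[of _ UNIV] fsupp_bracket[OF unit_words_pos[OF that]]]
    by (rule fsupp_subset) auto
  have "lsum (\<lambda>s. \<psi> (fst s) * S F (snd s)) (cop_red x)
    = (\<Sum>r=1..fst x. \<Sum>a\<in>unit_words (fst x - r). lsum (\<lambda>s. \<psi> (fst s) * S F (snd s))
        (\<lambda>t. of_nat (r + length a - 2 choose length a) * tensor (mono [(r, snd x)]) (bracket a) t))"
    unfolding cop_red_def
    by (subst lsum_sum[where A = UNIV], intro fsupp_sum fsupp_scale fs, assumption,
        intro sum.cong refl lsum_sum[where A = UNIV] fsupp_scale fs)
  also have "\<dots> = (\<Sum>r=1..fst x. kappa F (fst x) r * \<psi> [(r, snd x)])"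
  proof (rule sum.cong[OF refl])
    fix r
    have "lsum (\<lambda>s. \<psi> (fst s) * S F (snd s)) (tensor (mono [(r, snd x)]) (bracket a))
        = \<psi> [(r, snd x)] * lsum (S F) (bracket a)" if "a \<in> unit_words n" for a n
      by (subst lsum_tensor[OF fsupp_mono[of _ UNIV] fsupp_bracket[OF unit_words_pos[OF that]]])
         (simp_all add: lsum_fun_scale)
    then show "(\<Sum>a\<in>unit_words (fst x - r). lsum (\<lambda>s. \<psi> (fst s) * S F (snd s))
        (\<lambda>t. of_nat (r + length a - 2 choose length a) * tensor (mono [(r, snd x)]) (bracket a) t))
        = kappa F (fst x) r * \<psi> [(r, snd x)]"
      unfolding kappa_def sum_distrib_right lsum_scale emb_of_nat
      by (intro sum.cong refl) (simp add: mult_ac)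
  qed
  finally show ?thesis .
qed

lemma lsum_tensor_sh:
  assumes "b \<in> pos_words" "d \<in> pos_words" "flag F"
  shows "lsum (\<lambda>s. \<phi> (fst s) * S F (snd s)) (tensor (mono w) (sh b d)) = \<phi> w * (S F b * S F d)"
  by (subst lsum_tensor[OF fsupp_mono[of _ UNIV] fsupp_sh])
     (simp_all add: assms lsum_fun_scale S_sh)

text \<open>Shuffles occur only in the right factor, where \<open>S F\<close> is multiplicative; on
  the left letters are merely prepended, so \<open>\<phi>\<close> is arbitrary. With
  \<open>cop [] = tmono [] []\<close>, depth 1 follows the same formula.\<close>

lemma lsum_cop_Cons:
  assumes xw: "x # w \<in> pos_words" and F: "flag F"
  shows "lsum (\<lambda>s. \<phi> (fst s) * S F (snd s)) (cop (x # w)) = \<phi> [] * S F (x # w)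
    + (\<Sum>r=1..fst x. kappa F (fst x) r
        * lsum (\<lambda>s. \<phi> ((r, snd x) # fst s) * S F (snd s)) (cop w))"
proof (cases w)
  case Nil
  have "lsum (\<lambda>s. \<phi> (fst s) * S F (snd s)) (cop [x])
     = lsum (\<lambda>s. \<phi> (fst s) * S F (snd s)) (tmono [] [x])
       + lsum (\<lambda>s. \<phi> (fst s) * S F (snd s)) (cop_red x)"
    unfolding cop.simps cop_letter_eq
    by (rule lsum_add[where A = UNIV])
       (auto intro: fsupp_subset[OF fsupp_cop_red] fsupp_tmono[where A = UNIV and B = UNIV, simplified])
  then show ?thesis by (simp add: Nil lsum_cop_red)
next
  case (Cons y v)
  let ?\<Phi> = "\<lambda>s. \<phi> (fst s) * S F (snd s)"
  define \<psi> where "\<psi> a = lsum (\<lambda>s. \<phi> (a @ fst s) * S F (snd s)) (cop w)" for a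
  let ?t = "\<lambda>s s' t. cop_red x s * cop w s' * tensor (mono (fst s @ fst s')) (sh (snd s) (snd s')) t"
  have wpos: "w \<in> pos_words" using xw by simp
  have s: "snd s \<in> pos_words" if "s \<in> supp (cop_red x)" for s
    using fsuppD(2)[OF fsupp_cop_red that] by auto
  have s': "snd s \<in> pos_words" if "s \<in> supp (cop w)" for s
    using fsuppD(2)[OF fsupp_cop[OF wpos] that] by auto
  have fs: "tensor (mono a) (sh (snd s) (snd s')) \<in> fsupp UNIV"
    if "s \<in> supp (cop_red x)" "s' \<in> supp (cop w)" for a s s'
    using fsupp_tensor[OF fsupp_mono[of a UNIV] fsupp_sh[OF s[OF that(1)] s'[OF that(2)]]]
    by (rule fsupp_subset) auto
  have tm: "tmono [] (x # w) \<in> fsupp UNIV"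
    using fsupp_tmono[of "[]" UNIV "x # w" UNIV] by simp
  have eq: "cop (x # w) = (\<lambda>t. tmono [] (x # w) t + (\<Sum>s\<in>supp (cop_red x). \<Sum>s'\<in>supp (cop w). ?t s s' t))"
    unfolding Cons by (rule cop_Cons_Cons)
  have "lsum ?\<Phi> (cop (x # w)) = ?\<Phi> ([], x # w)
      + lsum ?\<Phi> (\<lambda>t. \<Sum>s\<in>supp (cop_red x). \<Sum>s'\<in>supp (cop w). ?t s s' t)"
    unfolding eq by (subst lsum_add[OF tm]) (intro fsupp_sum fsupp_scale fs, assumption+, simp)
  also have "lsum ?\<Phi> (\<lambda>t. \<Sum>s\<in>supp (cop_red x). \<Sum>s'\<in>supp (cop w). ?t s s' t)
      = (\<Sum>s\<in>supp (cop_red x). \<Sum>s'\<in>supp (cop w). lsum ?\<Phi> (?t s s'))"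
    by (subst lsum_sum[where A = UNIV], intro fsupp_sum fsupp_scale fs, assumption+,
        intro sum.cong refl lsum_sum[where A = UNIV] fsupp_scale fs)
  also have "\<dots> = (\<Sum>s\<in>supp (cop_red x). \<Sum>s'\<in>supp (cop w). emb (cop_red x s) *
      (emb (cop w s') * (\<phi> (fst s @ fst s') * S F (snd s')) * S F (snd s)))"
    by (intro sum.cong refl) (simp add: lsum_scale lsum_tensor_sh s s' F emb_mult mult_ac)
  also have "\<dots> = lsum (\<lambda>s. \<psi> (fst s) * S F (snd s)) (cop_red x)"
    by (simp add: lsum_def \<psi>_def sum_distrib_left sum_distrib_right)
  also have "\<dots> = (\<Sum>r=1..fst x. kappa F (fst x) r * \<psi> [(r, snd x)])"
    by (rule lsum_cop_red)
  finally show ?thesis by (simp add: \<psi>_def)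
qed

text \<open>Induction on the upper part. If it is empty, only the term with empty left factor
  survives. A new top level contributes a \<open>kappa\<close>-combination of levels of the upper
  flag, which \<open>level_append\<close> identifies with the level of the whole flag.\<close>

lemma S_append:
  assumes "flag (F' @ F)" "u \<in> pos_words"
  shows "lsum (\<lambda>s. S (upper F F') (fst s) * S F (snd s)) (cop u) = S (F' @ F) u"
  using assms
proof (induction F' arbitrary: u rule: span_of.induct)
  case 1
  then show ?case
    by (cases u) (simp_all add: upper_def lsum_cop_Cons[where \<phi> = "S []"])
next
  case (2 v k F')
  show ?case
  proof (cases u)
    case Nil
    then show ?thesis by simp
  next
    case (Cons x w)
    let ?G = "upper F F'" and ?e = "span.E F v" and ?n = "fst x"
    have fl: "flag (F' @ F)" "v \<notin> span_of (F' @ F)" "flag F"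
      using 2(2) flag_append[of F' F] by auto
    have pos: "x # w \<in> pos_words" "w \<in> pos_words" "?n \<ge> 1" using 2(3) Cons by auto
    have up: "upper F ((v, k) # F') = (?e, k) # ?G" by (simp add: upper_def)
    have "lsum (\<lambda>s. S ((?e, k) # ?G) (fst s) * S F (snd s)) (cop (x # w))
      = S F (x # w) + (\<Sum>r=1..?n. kappa F ?n r
          * (lsum (\<lambda>s. S ?G ((r, snd x) # fst s) * S F (snd s)) (cop w)
            + emb (snd x) ^ k * level ?G ?e r * lsum (\<lambda>s. S ?G (fst s) * S F (snd s)) (cop w)))"
      by (simp add: lsum_cop_Cons[OF pos(1) fl(3), where \<phi> = "S ((?e, k) # ?G)"] distrib_right lsum_fun_add mult.assoc lsum_fun_scale)
    also have "\<dots> = (S F (x # w) + (\<Sum>r=1..?n. kappa F ?n r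
          * lsum (\<lambda>s. S ?G ((r, snd x) # fst s) * S F (snd s)) (cop w)))
        + emb (snd x) ^ k * (\<Sum>r=1..?n. kappa F ?n r * level ?G ?e r)
            * lsum (\<lambda>s. S ?G (fst s) * S F (snd s)) (cop w)"
      by (simp add: distrib_left sum.distrib sum_distrib_left sum_distrib_right mult_ac)
    also have "S F (x # w) + (\<Sum>r=1..?n. kappa F ?n r
          * lsum (\<lambda>s. S ?G ((r, snd x) # fst s) * S F (snd s)) (cop w)) = S (F' @ F) (x # w)"
      using 2(1)[OF fl(1) pos(1)] by (simp add: lsum_cop_Cons[OF pos(1) fl(3), where \<phi> = "S ?G"])
    also have "(\<Sum>r=1..?n. kappa F ?n r * level ?G ?e r) = level (F' @ F) v ?n"
      by (rule level_append[symmetric, OF fl(1,2) pos(3)])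
    finally show ?thesis
      using 2(1)[OF fl(1) pos(2)] by (simp add: Cons up)
  qed
qed

section \<open>Separation of tensors and comparison of both sides\<close>

text \<open>Choose preimages under \<open>E\<close>; by \<open>span_upper\<close> they stay
  independent modulo the lower part. So for fixed \<open>F\<close> the upper flags exhaust all flags
  in the image of \<open>E\<close>.\<close>

lemma lift_upper:
  assumes "flag G" "fst ` set G \<subseteq> range (span.E F)" "flag F"
  shows "\<exists>F'. flag (F' @ F) \<and> upper F F' = G"
  using assms
proof (induction G rule: span_of.induct)
  case 1
  then show ?case by (auto simp: upper_def)
next
  case (2 e k G)
  then obtain F' where F': "flag (F' @ F)" "upper F F' = G" by auto
  obtain v where v: "e = span.E F v" using 2(3) by auto
  have "v \<notin> span_of (F' @ F)"
    using 2(2) v span_upper[of F F'] F'(2) by auto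
  then have "flag (((v, k) # F') @ F) \<and> upper F ((v, k) # F') = (e, k) # G"
    using F' v by (simp add: upper_def)
  then show ?case by blast
qed

text \<open>For fixed \<open>F\<close>, evaluating the right factor gives coefficients
  \<open>p F a\<close> in \<open>K\<close> for the left words \<open>a\<close>; they vanish by
  independence over the flags in the image of \<open>E\<close>. Varying \<open>F\<close> then kills
  the coefficients of \<open>T\<close>.\<close>

lemma tensor_independence:
  assumes T: "T \<in> fsupp (pos_words \<times> pos_words)"
    and 0: "\<And>F F'. flag (F' @ F) \<Longrightarrow> lsum (\<lambda>s. S (upper F F') (fst s) * S F (snd s)) T = 0"
  shows "T s = 0"
proof -
  define A where "A = fst ` supp T"
  define B where "B = snd ` supp T"
  have fin: "finite A" "finite B" using fsuppD(1)[OF T] by (auto simp: A_def B_def)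
  have pos: "A \<subseteq> pos_words" "B \<subseteq> pos_words" using T by (auto simp: A_def B_def fsupp_def)
  have sub: "supp T \<subseteq> A \<times> B" by (force simp: A_def B_def)
  have T0: "T (a, b) = 0" if "a \<notin> A \<or> b \<notin> B" for a b using sub that by (auto simp: supp_def)
  have ksum: "ksum F p = (\<Sum>w\<in>C. p w * S F w)" if "finite C" "supp p \<subseteq> C" for F p C
    unfolding ksum_def using that by (intro sum.mono_neutral_left) (auto simp: supp_def)
  define p where "p F a = (\<Sum>b\<in>B. emb (T (a, b)) * S F b)" for F a
  have p: "p F \<in> fsupp pos_words" for F
    by (rule fsuppI[OF fin(1) pos(1)]) (simp add: p_def T0)
  have p0: "p F a = 0" if F: "flag F" for F a
  proof (rule S_independence[OF span.infinite_range_E p])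
    fix G assume "flag G" "fst ` set G \<subseteq> range (span.E F)"
    then obtain F' where F': "flag (F' @ F)" "upper F F' = G" using lift_upper F by blast
    have "ksum G (p F) = (\<Sum>a\<in>A. p F a * S G a)"
      by (rule ksum[OF fin(1)]) (auto simp: supp_def p_def T0 intro: ccontr)
    also have "\<dots> = (\<Sum>a\<in>A. \<Sum>b\<in>B. emb (T (a, b)) * (S G a * S F b))"
      unfolding p_def sum_distrib_right by (simp only: mult_ac)
    also have "\<dots> = lsum (\<lambda>s. S G (fst s) * S F (snd s)) T"
      using fin by (subst lsum_superset[OF _ sub]) (simp_all add: sum.cartesian_product case_prod_unfold)
    finally show "ksum G (p F) = 0" using 0[OF F'(1)] F'(2) by simp
  qed
  have "emb (T (a, b)) = 0" for a b
  proof (rule S_independence[OF infinite_K, where p = "\<lambda>b. emb (T (a, b))"])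
    show "(\<lambda>b. emb (T (a, b))) \<in> fsupp pos_words"
      by (rule fsuppI[OF fin(2) pos(2)]) (simp add: T0)
    fix F assume "flag F"
    have "ksum F (\<lambda>b. emb (T (a, b))) = p F a"
      unfolding p_def by (rule ksum[OF fin(2)]) (auto simp: supp_def T0 intro: ccontr)
    then show "ksum F (\<lambda>b. emb (T (a, b))) = 0" using p0[OF \<open>flag F\<close>] by simp
  qed
  then show ?thesis by (cases s) auto
qed

text \<open>Each factor is evaluated by a multiplicative functional: \<open>S F\<close> on the right
  and \<open>\<phi>\<close> on the left, later the value on the upper flag.\<close>

lemma lsum_tshE:
  assumes T: "T1 \<in> fsupp (pos_words \<times> pos_words)" "T2 \<in> fsupp (pos_words \<times> pos_words)"
    and mult: "\<And>a c. a \<in> pos_words \<Longrightarrow> c \<in> pos_words \<Longrightarrow> lsum \<phi> (sh a c) = \<phi> a * \<phi> c"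
    and F: "flag F"
  shows "lsum (\<lambda>s. \<phi> (fst s) * S F (snd s)) (tshE T1 T2)
    = lsum (\<lambda>s. \<phi> (fst s) * S F (snd s)) T1 * lsum (\<lambda>s. \<phi> (fst s) * S F (snd s)) T2"
proof -
  let ?\<Phi> = "\<lambda>s. \<phi> (fst s) * S F (snd s)"
  let ?t = "\<lambda>s s'. tensor (sh (fst s) (fst s')) (sh (snd s) (snd s'))"
  have pos: "fst s \<in> pos_words" "snd s \<in> pos_words" if "s \<in> supp T1 \<or> s \<in> supp T2" for s
    using that fsuppD(2)[OF T(1), of s] fsuppD(2)[OF T(2), of s] by (auto simp: mem_Times_iff)
  have fs: "?t s s' \<in> fsupp (pos_words \<times> pos_words)" if "s \<in> supp T1" "s' \<in> supp T2" for s s'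
    using that by (intro fsupp_tensor fsupp_sh pos) auto
  have "lsum ?\<Phi> (tshE T1 T2)
      = (\<Sum>s\<in>supp T1. \<Sum>s'\<in>supp T2. lsum ?\<Phi> (\<lambda>t. T1 s * T2 s' * ?t s s' t))"
    unfolding tshE_alt
    by (subst lsum_sum[where A = "pos_words \<times> pos_words"], intro fsupp_sum fsupp_scale fs, assumption+,
        intro sum.cong refl lsum_sum[where A = "pos_words \<times> pos_words"] fsupp_scale fs)
  also have "\<dots> = (\<Sum>s\<in>supp T1. \<Sum>s'\<in>supp T2. (emb (T1 s) * ?\<Phi> s) * (emb (T2 s') * ?\<Phi> s'))"
  proof (intro sum.cong refl)
    fix s s' assume s: "s \<in> supp T1" "s' \<in> supp T2"
    then have "lsum ?\<Phi> (?t s s') = ?\<Phi> s * ?\<Phi> s'"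
      using pos
      by (subst lsum_tensor[OF fsupp_sh fsupp_sh])
         (simp_all add: lsum_fun_scale lsum_fun_scale_right S_sh F mult)
    then show "lsum ?\<Phi> (\<lambda>t. T1 s * T2 s' * ?t s s' t) = (emb (T1 s) * ?\<Phi> s) * (emb (T2 s') * ?\<Phi> s')"
      by (simp add: lsum_scale emb_mult)
  qed
  finally show ?thesis by (simp add: lsum_def sum_product)
qed

lemma flag_upper: "flag (F' @ F) \<Longrightarrow> flag (upper F F')"
proof (induction F' rule: span_of.induct)
  case (2 v k F')
  have "span.E F v \<notin> span.E F ` span_of (F' @ F)"
  proof
    assume "span.E F v \<in> span.E F ` span_of (F' @ F)"
    then obtain c where "c \<in> span_of (F' @ F)" "v - c \<in> span_of F"
      by (auto simp: span.E_eq_iff)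
    then have "(v - c) + c \<in> span_of (F' @ F)" using span_append span.add_U by blast
    then show False using 2 by simp
  qed
  then show ?case using 2 by (simp add: span_upper[symmetric]) (simp add: upper_def)
qed (simp add: upper_def)

theorem cop_mult:
  fixes u v :: "'k word"
  assumes u: "u \<in> pos_words" and v: "v \<in> pos_words"
  shows "copE (shE (mono u) (mono v)) = tshE (cop u) (cop v)"
proof
  fix s
  let ?p = "shE (mono u) (mono v) :: 'k elem"
  have p: "?p \<in> fsupp pos_words" using u v by (intro fsupp_shE fsupp_mono)
  have T1: "copE ?p \<in> fsupp (pos_words \<times> pos_words)"
    unfolding copE_def by (rule fsupp_lin[OF p]) (rule fsupp_cop)
  have T2: "tshE (cop u) (cop v) \<in> fsupp (pos_words \<times> pos_words)"
    using u v by (intro fsupp_tshE fsupp_cop)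
  have "copE ?p s - tshE (cop u) (cop v) s = 0"
  proof (rule tensor_independence[OF fsupp_diff[OF T1 T2]])
    fix F F' assume F: "flag (F' @ F)"
    let ?\<Phi> = "\<lambda>s. S (upper F F') (fst s) * S F (snd s)"
    have "lsum ?\<Phi> (copE ?p) = lsum (\<lambda>w. lsum ?\<Phi> (cop w)) ?p"
      unfolding copE_def by (rule lsum_lin[OF p fsupp_cop])
    also have "\<dots> = lsum (S (F' @ F)) ?p"
      by (rule lsum_cong[OF p]) (rule S_append[OF F])
    also have "\<dots> = S (F' @ F) u * S (F' @ F) v"
      using u v F by (subst S_shE) (auto intro: fsupp_mono)
    also have "\<dots> = lsum ?\<Phi> (cop u) * lsum ?\<Phi> (cop v)"
      by (simp add: S_append[OF F] u v)
    also have "\<dots> = lsum ?\<Phi> (tshE (cop u) (cop v))"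
      by (rule lsum_tshE[symmetric])
         (auto intro: fsupp_cop u v S_sh flag_upper[OF F] flag_append[OF F])
    finally show "lsum ?\<Phi> (\<lambda>s. copE ?p s - tshE (cop u) (cop v) s) = 0"
      by (simp add: lsum_diff[OF T1 T2])
  qed
  then show "copE ?p s = tshE (cop u) (cop v) s" by simp
qed

end

lemma infinite_UNIV_fls: "infinite (UNIV :: 'a::field fls set)"
proof
  assume "finite (UNIV :: 'a fls set)"
  then have "inj (\<lambda>n::nat. fls_X ^ n :: 'a fls) \<Longrightarrow> False"
    using finite_subset[OF subset_UNIV] finite_imageD infinite_UNIV_nat by blast
  moreover have "inj (\<lambda>n::nat. fls_X ^ n :: 'a fls)"
  proof (rule injI)
    fix m n :: nat assume "(fls_X ^ m :: 'a fls) = fls_X ^ n"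
    then have "fls_nth (fls_X ^ m :: 'a fls) (int m) = fls_nth (fls_X ^ n) (int m)" by simp
    then show "m = n" by (simp split: if_splits)
  qed
  ultimately show False by blast
qed

theorem theorem6p5:
  fixes u v :: "('k::{field,finite}) word"
  assumes "valid_word u" and "valid_word v"
  shows "copE (shE (mono u) (mono v)) = tshE (cop u) (cop v)"
proof -
  \<comment> \<open>Laurent series over F_q form an infinite field containing F_q as its
    constants.\<close>
  interpret field_embedding "fls_const :: 'k \<Rightarrow> 'k fls"
    by unfold_locales (simp_all add: fls_plus_const infinite_UNIV_fls)
  show ?thesis
    using assms by (intro cop_mult) (auto simp: valid_word_def pos_words_def)
qed

end
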